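(* Let $m\ge d+1$ (i.e. $m\ge 2$ when $d=1$). One time step $f^n\mapsto f^{n+1}$ (step size $\tau>0$) of the robust and conservative dynamical low-rank integrator described in the context satisfies the following discrete version of the momentum continuity equation: $$\frac{j^{n+1}-j^n}{\tau}+\nabla_x\cdot\sigma^n+E^n\rho^n=0 ,$$ where $\rho^n=\int_{\Omega_v}f^n\,dv$, $j^{n}=\int_{\Omega_v}v f^{n}\,dv$, $j^{n+1}=\int_{\Omega_v}v f^{n+1}\,dv$, $\sigma^n=\int_{\Omega_v}(v\otimes v)f^n\,dv$ and $E^n=E(f^n)$. Consequently the integrator preserves the total momentum, i.e. $\int_\Omega v f^{n+1}\,d(x,v)=\int_\Omega v f^{n}\,d(x,v)$.
   Context: **Problem.** $\Omega=\Omega_x\times\Omega_v$ with $\Omega_x,\Omega_v\subset\mathbb R^d$. The Vlasov--Poisson equations are $\partial_t f=\mathrm{RHS}[f]$ with $\mathrm{RHS}[f]=-v\cdot\nabla_x f+E(f)\cdot\nabla_v f$, where $E(f)=-\nabla_x\phi$ and $-\Delta_x\phi=1-\int_{\Omega_v} f\,dv$ (so $\nabla_x\cdot E(f)=1-\int_{\Omega_v} f\,dv$). $\Omega_x$ is a box with periodic boundary conditions and $\int_{\Omega} f\,d(x,v)=|\Omega_x|$. All functions are sufficiently smooth, and sufficiently decaying in $v$, so that all integrals below exist; $\int_{\Omega_x}\nabla_x u\,dx=0$ (in particular $\int_{\Omega_x}E(f)\,dx=0$), and integration by parts in $v$ produces no boundary terms. Space and velocity are kept continuous. **Notation.** $f_{0v}>0$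 is a weight function on $\Omega_v$ decaying fast enough that $1$, the components $v_1,\dots,v_d$ of $v$, and $v^2:=\sum_i v_i^2$ lie in $L^2(\Omega_v,f_{0v})$. Set $\langle a,b\rangle_x=\int_{\Omega_x}ab\,dx$, $\langle a,b\rangle_v=\int_{\Omega_v}f_{0v}\,ab\,dv$, $\|w\|=\sqrt{\langle w,w\rangle_v}$, $(a,b)_v=\int_{\Omega_v}ab\,dv$, $(a,b)_{xv}=\int_\Omega ab\,d(x,v)$. **Low-rank representation.** $f^n=f_{0v}\sum_{i,j=1}^r X_i^n(x)S_{ij}^nV_j^n(v)$ with $S^n\in\mathbb R^{r\times r}$, $(X_i^n)_i$ orthonormal for $\langle\cdot,\cdot\rangle_x$, $(V_j^n)_j$ orthonormal for $\langle\cdot,\cdot\rangle_v$. The first $m\le r$ functions are fixed in time: $V_a^n=U_a$ for $1\le a\le m$; the others are $V_p^n=W_p^n$ for $m<p\le r$. The fixed functions are, in this order and as far as the index does not exceed $m$: $U_1=1/\|1\|$, $U_{s+1}=v_s/\|v_s\|$ ($1\le s\le d$), $U_{d+2}=(v^2-c)/\|v^2-c\|$ with $c$ the constant making $v^2-c$ orthogonal to $1$ in $\langle\cdot,\cdot\rangle_v$ ($c=1$ for $d=1$, $f_{0v}=e^{-v^2/2}$, $\Omega_v=\mathbb R$); the weight is such that the $U_a$ are orthonormal. **One step of the integrator** (Algorithm 1), with $\mathrm{RHS}^n=\mathrm{RHS}[f^n]$: 1. Set $K_k^n=\sum_iX_i^nS_{ik}^n$ and $K_k^{n+1}=K_k^n+\tau(V_k^n,\mathrm{RHS}^n)_v$,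 $1\le k\le r$. Set $L_q^n=\sum_{i=1}^r\sum_{p=m+1}^r S_{iq}^nS_{ip}^nW_p^n$ and $L_q^{n+1}=L_q^n+\frac{\tau}{f_{0v}}\sum_iS_{iq}^n\langle X_i^n,\mathrm{RHS}^n\rangle_x-\tau\sum_{i,l}S_{iq}^n(X_i^nV_l^n,\mathrm{RHS}^n)_{xv}V_l^n$, $m+1\le q\le r$. 2. $(\widetilde X_k^{n+1})_k$ is an orthonormal basis (for $\langle\cdot,\cdot\rangle_x$) of the span of all $X_i^n$, all components of all $\nabla_xX_i^n$, and all $K_i^{n+1}$. 3. $(\widetilde V_l^{n+1})_l$ is an orthonormal basis (for $\langle\cdot,\cdot\rangle_v$) of the span of all $U_a$, $L_q^{n+1}$, $W_p^n$, chosen such that $\widetilde V_a^{n+1}=U_a$ for $a\le m$; denote the remaining functions by $\widetilde W^{n+1}$. 4. With $M_{ki}=\langle\widetilde X_k^{n+1},X_i^n\rangle_x$, $N^T_{jl}=\langle V_j^n,\widetilde V_l^{n+1}\rangle_v$ and $g=f_{0v}\sum_{k,i,j,l}\widetilde X_k^{n+1}M_{ki}S_{ij}^nN^T_{jl}\widetilde V_l^{n+1}$, set $\widetilde S_{kl}^{n+1}=\sum_{i,j}M_{ki}S_{ij}^nN^T_{jl}+\tau(\widetilde X_k^{n+1}\widetilde V_l^{n+1},\mathrm{RHS}[g])_{xv}$. 5. (Truncation to rank $r$.) Regarding families of functions as matrices whose columns are the functions, set $\widetilde K=\widetilde X^{n+1}\widetilde S^{n+1}=[\widetilde K^{cons}\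 \widetilde K^{rem}]$, where $\widetilde K^{cons}$ consists of the first $m$ columns. Take QR decompositions (first factor with orthonormal columns) $\widetilde K^{cons}=X^{cons}S^{cons}$, $\widetilde K^{rem}=\widetilde X^{rem}\widetilde S^{rem}$. Let $\hat U\hat S\hat W^T$ be the singular value decomposition of $\widetilde S^{rem}$ truncated to the $r-m$ largest singular values; set $X^{rem}=\widetilde X^{rem}\hat U$, $S^{rem}=\hat S$, $W^{n+1}=\widetilde W^{n+1}\hat W$, $V^{n+1}=[U\ W^{n+1}]$. Take a QR decomposition $[X^{cons}\ X^{rem}]=X^{n+1}R$ and set $S^{n+1}=R\begin{bmatrix}S^{cons}&0\\0&S^{rem}\end{bmatrix}$. 6. $f^{n+1}=f_{0v}\sum_{i,j=1}^rX_i^{n+1}S_{ij}^{n+1}V_j^{n+1}$. *)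

theory Defs
  imports "HOL-Analysis.Analysis"
begin

definition partial :: "'d::finite \<Rightarrow> (real^'d \<Rightarrow> real) \<Rightarrow> real^'d \<Rightarrow> real" where
  "partial i h x = deriv (\<lambda>s. h (x + s *\<^sub>R axis i 1)) 0"

definition grad :: "(real^'d \<Rightarrow> real) \<Rightarrow> real^'d \<Rightarrow> real^'d" where
  "grad h x = (\<chi> i. partial i h x)"

definition laplacian :: "(real^'d \<Rightarrow> real) \<Rightarrow> real^'d \<Rightarrow> real" where
  "laplacian h x = (\<Sum>i\<in>UNIV. partial i (partial i h) x)"

definition div_tensor :: "(real^'d \<Rightarrow> real^'d^'d) \<Rightarrow> real^'d \<Rightarrow> real^'d" where
  "div_tensor A x = (\<chi> i. \<Sum>j\<in>UNIV. partial j (\<lambda>y. A y $ i $ j) x)"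

(* Both notions are only used for open D. *)
definition C1_on :: "(real^'d) set \<Rightarrow> (real^'d \<Rightarrow> real) \<Rightarrow> bool" where
  "C1_on D h \<longleftrightarrow> h differentiable_on D \<and> (\<forall>i. continuous_on D (partial i h))"

definition C2_on :: "(real^'d) set \<Rightarrow> (real^'d \<Rightarrow> real) \<Rightarrow> bool" where
  "C2_on D h \<longleftrightarrow> C1_on D h \<and> (\<forall>i. C1_on D (partial i h))"

text \<open>
  The spatial domain is the box \<open>cbox a b\<close> with periodic boundary conditions: functions of
  \<open>x\<close> are periodic functions on the whole space, and are integrated over the box.  The velocity
  domain is a set \<open>\<Omega>v\<close> (open, in the statement); functions of \<open>v\<close> are total functions of which
  only the values on \<open>\<Omega>v\<close> matter.  Families are indexed from 1, as are rows and columns of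
  matrices.
\<close>

definition periodic :: "real^'d \<Rightarrow> real^'d \<Rightarrow> (real^'d \<Rightarrow> real) \<Rightarrow> bool" where
  "periodic a b h \<longleftrightarrow> (\<forall>x i. h (x + (b $ i - a $ i) *\<^sub>R axis i 1) = h x)"

definition ip_x :: "real^'d \<Rightarrow> real^'d \<Rightarrow> (real^'d \<Rightarrow> real) \<Rightarrow> (real^'d \<Rightarrow> real) \<Rightarrow> real" where
  "ip_x a b u w = (LINT x:cbox a b|lborel. u x * w x)"

definition ip_v :: "(real^'d) set \<Rightarrow> (real^'d \<Rightarrow> real) \<Rightarrow> (real^'d \<Rightarrow> real) \<Rightarrow> (real^'d \<Rightarrow> real) \<Rightarrow> real" where
  "ip_v \<Omega>v f0v u w = (LINT v:\<Omega>v|lborel. f0v v * (u v * w v))"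

definition norm_v :: "(real^'d) set \<Rightarrow> (real^'d \<Rightarrow> real) \<Rightarrow> (real^'d \<Rightarrow> real) \<Rightarrow> real" where
  "norm_v \<Omega>v f0v w = sqrt (ip_v \<Omega>v f0v w w)"

definition pair_v :: "(real^'d) set \<Rightarrow> (real^'d \<Rightarrow> real) \<Rightarrow> (real^'d \<Rightarrow> real) \<Rightarrow> real" where
  "pair_v \<Omega>v u w = (LINT v:\<Omega>v|lborel. u v * w v)"

definition pair_xv ::
  "real^'d \<Rightarrow> real^'d \<Rightarrow> (real^'d) set \<Rightarrow> (real^'d \<Rightarrow> real^'d \<Rightarrow> real) \<Rightarrow> (real^'d \<Rightarrow> real^'d \<Rightarrow> real) \<Rightarrow> real" where
  "pair_xv a b \<Omega>v u w =
     (LINT z:cbox a b \<times> \<Omega>v|lborel. u (fst z) (snd z) * w (fst z) (snd z))"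

definition L2_x :: "real^'d \<Rightarrow> real^'d \<Rightarrow> (real^'d \<Rightarrow> real) \<Rightarrow> bool" where
  "L2_x a b w \<longleftrightarrow> periodic a b w \<and> w \<in> borel_measurable lborel
     \<and> set_integrable lborel (cbox a b) (\<lambda>x. (w x)\<^sup>2)"

definition L2_v :: "(real^'d) set \<Rightarrow> (real^'d \<Rightarrow> real) \<Rightarrow> (real^'d \<Rightarrow> real) \<Rightarrow> bool" where
  "L2_v \<Omega>v f0v w \<longleftrightarrow> set_borel_measurable lborel \<Omega>v w
     \<and> set_integrable lborel \<Omega>v (\<lambda>v. f0v v * (w v)\<^sup>2)"

definition orthonormal_x :: "real^'d \<Rightarrow> real^'d \<Rightarrow> nat \<Rightarrow> (nat \<Rightarrow> real^'d \<Rightarrow> real) \<Rightarrow> bool" where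
  "orthonormal_x a b n Q \<longleftrightarrow> (\<forall>i\<in>{1..n}. L2_x a b (Q i))
     \<and> (\<forall>i\<in>{1..n}. \<forall>j\<in>{1..n}. ip_x a b (Q i) (Q j) = (if i = j then 1 else 0))"

definition orthonormal_v ::
  "(real^'d) set \<Rightarrow> (real^'d \<Rightarrow> real) \<Rightarrow> nat \<Rightarrow> (nat \<Rightarrow> real^'d \<Rightarrow> real) \<Rightarrow> bool" where
  "orthonormal_v \<Omega>v f0v n Q \<longleftrightarrow> (\<forall>i\<in>{1..n}. L2_v \<Omega>v f0v (Q i))
     \<and> (\<forall>i\<in>{1..n}. \<forall>j\<in>{1..n}. ip_v \<Omega>v f0v (Q i) (Q j) = (if i = j then 1 else 0))"

(* The functions that agree on D with a linear combination of members of F. *)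
definition span_on :: "'a set \<Rightarrow> ('a \<Rightarrow> real) set \<Rightarrow> ('a \<Rightarrow> real) set" where
  "span_on D F =
     {h. \<exists>T c. finite T \<and> T \<subseteq> F \<and> (\<forall>x\<in>D. h x = (\<Sum>u\<in>T. c u * u x))}"

definition rho :: "(real^'d) set \<Rightarrow> (real^'d \<Rightarrow> real^'d \<Rightarrow> real) \<Rightarrow> real^'d \<Rightarrow> real" where
  "rho \<Omega>v f x = (LINT v:\<Omega>v|lborel. f x v)"

definition momentum :: "(real^'d) set \<Rightarrow> (real^'d \<Rightarrow> real^'d \<Rightarrow> real) \<Rightarrow> real^'d \<Rightarrow> real^'d" where
  "momentum \<Omega>v f x = (LINT v:\<Omega>v|lborel. f x v *\<^sub>R v)"

definition stress :: "(real^'d) set \<Rightarrow> (real^'d \<Rightarrow> real^'d \<Rightarrow> real) \<Rightarrow> real^'d \<Rightarrow> real^'d^'d" where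
  "stress \<Omega>v f x = (LINT v:\<Omega>v|lborel. f x v *\<^sub>R (\<chi> i j. v $ i * v $ j))"

definition poisson_potential ::
  "real^'d \<Rightarrow> real^'d \<Rightarrow> (real^'d) set \<Rightarrow> (real^'d \<Rightarrow> real^'d \<Rightarrow> real) \<Rightarrow> (real^'d \<Rightarrow> real) \<Rightarrow> bool" where
  "poisson_potential a b \<Omega>v f \<phi> \<longleftrightarrow> C2_on UNIV \<phi> \<and> periodic a b \<phi>
     \<and> (\<forall>x. - laplacian \<phi> x = 1 - rho \<Omega>v f x)"

(* Periodic potentials differ by additive constants only, so the choice does not affect the field. *)
definition E_field ::
  "real^'d \<Rightarrow> real^'d \<Rightarrow> (real^'d) set \<Rightarrow> (real^'d \<Rightarrow> real^'d \<Rightarrow> real) \<Rightarrow> real^'d \<Rightarrow> real^'d" where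
  "E_field a b \<Omega>v f x = - grad (SOME \<phi>. poisson_potential a b \<Omega>v f \<phi>) x"

definition RHS ::
  "real^'d \<Rightarrow> real^'d \<Rightarrow> (real^'d) set \<Rightarrow> (real^'d \<Rightarrow> real^'d \<Rightarrow> real) \<Rightarrow> real^'d \<Rightarrow> real^'d \<Rightarrow> real" where
  "RHS a b \<Omega>v f x v =
     - (v \<bullet> grad (\<lambda>y. f y v) x) + E_field a b \<Omega>v f x \<bullet> grad (f x) v"

definition vsq :: "real^'d \<Rightarrow> real" where
  "vsq v = (\<Sum>i\<in>UNIV. (v $ i)\<^sup>2)"

definition energy_shift :: "(real^'d) set \<Rightarrow> (real^'d \<Rightarrow> real) \<Rightarrow> real" where
  "energy_shift \<Omega>v f0v = (THE c. ip_v \<Omega>v f0v (\<lambda>v. vsq v - c) (\<lambda>_. 1) = 0)"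

(* e enumerates the coordinates: v $ e s is the s-th component of v, for s from 1 to d.
   Only indices from 1 to d + 2 are meaningful. *)
definition fixed_fun ::
  "(real^'d) set \<Rightarrow> (real^'d \<Rightarrow> real) \<Rightarrow> (nat \<Rightarrow> 'd) \<Rightarrow> nat \<Rightarrow> real^'d \<Rightarrow> real" where
  "fixed_fun \<Omega>v f0v e k =
     (let w = (if k = 1 then (\<lambda>v. 1)
               else if k \<le> CARD('d) + 1 then (\<lambda>v. v $ e (k - 1))
               else (\<lambda>v. vsq v - energy_shift \<Omega>v f0v))
      in (\<lambda>v. w v / norm_v \<Omega>v f0v w))"

definition admissible_weight ::
  "(real^'d) set \<Rightarrow> (real^'d \<Rightarrow> real) \<Rightarrow> (nat \<Rightarrow> 'd) \<Rightarrow> nat \<Rightarrow> bool" where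
  "admissible_weight \<Omega>v f0v e m \<longleftrightarrow>
     (\<forall>v\<in>\<Omega>v. f0v v > 0) \<and> C1_on \<Omega>v f0v
     \<and> L2_v \<Omega>v f0v (\<lambda>_. 1) \<and> (\<forall>i. L2_v \<Omega>v f0v (\<lambda>v. v $ i)) \<and> L2_v \<Omega>v f0v vsq
     \<and> orthonormal_v \<Omega>v f0v m (fixed_fun \<Omega>v f0v e)"

definition lowrank ::
  "(real^'d \<Rightarrow> real) \<Rightarrow> nat \<Rightarrow> nat \<Rightarrow> (nat \<Rightarrow> real^'d \<Rightarrow> real) \<Rightarrow> (nat \<Rightarrow> nat \<Rightarrow> real)
     \<Rightarrow> (nat \<Rightarrow> real^'d \<Rightarrow> real) \<Rightarrow> real^'d \<Rightarrow> real^'d \<Rightarrow> real" where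
  "lowrank f0v p q X S V x v =
     f0v v * (\<Sum>i=1..p. \<Sum>j=1..q. X i x * S i j * V j v)"

text \<open>
  The last two conjuncts make precise that the functions decay sufficiently in \<open>v\<close>: all
  integrals against functions in the weighted \<open>L\<^sup>2\<close> space exist by the Cauchy--Schwarz
  inequality, and integration by parts against the fixed functions has no boundary terms.
\<close>

definition lowrank_factors ::
  "real^'d \<Rightarrow> real^'d \<Rightarrow> (real^'d) set \<Rightarrow> (real^'d \<Rightarrow> real) \<Rightarrow> (nat \<Rightarrow> 'd) \<Rightarrow> nat \<Rightarrow> nat
     \<Rightarrow> (nat \<Rightarrow> real^'d \<Rightarrow> real) \<Rightarrow> (nat \<Rightarrow> real^'d \<Rightarrow> real) \<Rightarrow> bool" where
  "lowrank_factors a b \<Omega>v f0v e m r X V \<longleftrightarrow>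
     orthonormal_x a b r X \<and> (\<forall>i\<in>{1..r}. C1_on UNIV (X i))
     \<and> orthonormal_v \<Omega>v f0v r V \<and> (\<forall>j\<in>{1..r}. C1_on \<Omega>v (V j))
     \<and> (\<forall>k\<in>{1..m}. \<forall>v\<in>\<Omega>v. V k v = fixed_fun \<Omega>v f0v e k v)
     \<and> (\<forall>j\<in>{1..r}. \<forall>t.
          L2_v \<Omega>v f0v (\<lambda>v. v $ t * V j v)
          \<and> L2_v \<Omega>v f0v (\<lambda>v. partial t (\<lambda>w. f0v w * V j w) v / f0v v))
     \<and> (\<forall>k\<in>{1..m}. \<forall>j\<in>{1..r}. \<forall>t.
          (LINT v:\<Omega>v|lborel. fixed_fun \<Omega>v f0v e k v * partial t (\<lambda>w. f0v w * V j w) v)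
          = - (LINT v:\<Omega>v|lborel. partial t (fixed_fun \<Omega>v f0v e k) v * (f0v v * V j v)))"

definition K_new ::
  "real^'d \<Rightarrow> real^'d \<Rightarrow> (real^'d) set \<Rightarrow> (real^'d \<Rightarrow> real) \<Rightarrow> real \<Rightarrow> nat
     \<Rightarrow> (nat \<Rightarrow> real^'d \<Rightarrow> real) \<Rightarrow> (nat \<Rightarrow> nat \<Rightarrow> real) \<Rightarrow> (nat \<Rightarrow> real^'d \<Rightarrow> real)
     \<Rightarrow> nat \<Rightarrow> real^'d \<Rightarrow> real" where
  "K_new a b \<Omega>v f0v \<tau> r X S V k x =
     (\<Sum>i=1..r. X i x * S i k)
     + \<tau> * pair_v \<Omega>v (V k) (RHS a b \<Omega>v (lowrank f0v r r X S V) x)"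

definition L_new ::
  "real^'d \<Rightarrow> real^'d \<Rightarrow> (real^'d) set \<Rightarrow> (real^'d \<Rightarrow> real) \<Rightarrow> real \<Rightarrow> nat \<Rightarrow> nat
     \<Rightarrow> (nat \<Rightarrow> real^'d \<Rightarrow> real) \<Rightarrow> (nat \<Rightarrow> nat \<Rightarrow> real) \<Rightarrow> (nat \<Rightarrow> real^'d \<Rightarrow> real)
     \<Rightarrow> nat \<Rightarrow> real^'d \<Rightarrow> real" where
  "L_new a b \<Omega>v f0v \<tau> m r X S V q v =
     (let F = RHS a b \<Omega>v (lowrank f0v r r X S V) in
      (\<Sum>i=1..r. \<Sum>p=m+1..r. S i q * S i p * V p v)
      + \<tau> / f0v v * (\<Sum>i=1..r. S i q * ip_x a b (X i) (\<lambda>x. F x v))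
      - \<tau> * (\<Sum>i=1..r. \<Sum>l=1..r.
               S i q * pair_xv a b \<Omega>v (\<lambda>x w. X i x * V l w) F * V l v))"

(* A = Q R, where A has q columns, Q has p orthonormal columns and R is upper triangular
   (trapezoidal if p and q differ). *)
definition is_QR_x ::
  "real^'d \<Rightarrow> real^'d \<Rightarrow> nat \<Rightarrow> nat \<Rightarrow> (nat \<Rightarrow> real^'d \<Rightarrow> real) \<Rightarrow> (nat \<Rightarrow> real^'d \<Rightarrow> real)
     \<Rightarrow> (nat \<Rightarrow> nat \<Rightarrow> real) \<Rightarrow> bool" where
  "is_QR_x a b p q A Q R \<longleftrightarrow>
     orthonormal_x a b p Q
     \<and> (\<forall>i\<in>{1..p}. \<forall>j\<in>{1..q}. j < i \<longrightarrow> R i j = 0)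
     \<and> (\<forall>j\<in>{1..q}. \<forall>x. A j x = (\<Sum>i=1..p. Q i x * R i j))"

definition orthonormal_columns :: "nat \<Rightarrow> nat \<Rightarrow> (nat \<Rightarrow> nat \<Rightarrow> real) \<Rightarrow> bool" where
  "orthonormal_columns p n U \<longleftrightarrow>
     (\<forall>k\<in>{1..n}. \<forall>l\<in>{1..n}. (\<Sum>i=1..p. U i k * U i l) = (if k = l then 1 else 0))"

(* Reduced decomposition of a p x q matrix with nonincreasing singular values s; truncation to the
   k largest singular values keeps the first k columns of U and W. *)
definition is_SVD ::
  "nat \<Rightarrow> nat \<Rightarrow> (nat \<Rightarrow> nat \<Rightarrow> real) \<Rightarrow> (nat \<Rightarrow> nat \<Rightarrow> real) \<Rightarrow> (nat \<Rightarrow> real)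
     \<Rightarrow> (nat \<Rightarrow> nat \<Rightarrow> real) \<Rightarrow> bool" where
  "is_SVD p q A U s W \<longleftrightarrow>
     orthonormal_columns p (min p q) U \<and> orthonormal_columns q (min p q) W
     \<and> (\<forall>k\<in>{1..min p q}. 0 \<le> s k)
     \<and> (\<forall>k\<in>{1..min p q}. \<forall>l\<in>{1..min p q}. k \<le> l \<longrightarrow> s l \<le> s k)
     \<and> (\<forall>i\<in>{1..p}. \<forall>j\<in>{1..q}. A i j = (\<Sum>k=1..min p q. U i k * s k * W j k))"

definition augmented_bases ::
  "real^'d \<Rightarrow> real^'d \<Rightarrow> (real^'d) set \<Rightarrow> (real^'d \<Rightarrow> real) \<Rightarrow> (nat \<Rightarrow> 'd) \<Rightarrow> real \<Rightarrow> nat \<Rightarrow> nat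
     \<Rightarrow> (nat \<Rightarrow> real^'d \<Rightarrow> real) \<Rightarrow> (nat \<Rightarrow> nat \<Rightarrow> real) \<Rightarrow> (nat \<Rightarrow> real^'d \<Rightarrow> real)
     \<Rightarrow> nat \<Rightarrow> (nat \<Rightarrow> real^'d \<Rightarrow> real) \<Rightarrow> nat \<Rightarrow> (nat \<Rightarrow> real^'d \<Rightarrow> real) \<Rightarrow> bool" where
  "augmented_bases a b \<Omega>v f0v e \<tau> m r X S V nx Xt nv Vt \<longleftrightarrow>
     orthonormal_x a b nx Xt
     \<and> span_on UNIV (Xt ` {1..nx}) =
         span_on UNIV (X ` {1..r} \<union> {partial s (X i) | s i. i \<in> {1..r}}
                       \<union> K_new a b \<Omega>v f0v \<tau> r X S V ` {1..r})
     \<and> orthonormal_v \<Omega>v f0v nv Vt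
     \<and> span_on \<Omega>v (Vt ` {1..nv}) =
         span_on \<Omega>v (fixed_fun \<Omega>v f0v e ` {1..m}
                      \<union> L_new a b \<Omega>v f0v \<tau> m r X S V ` {m+1..r}
                      \<union> V ` {m+1..r})
     \<and> m \<le> nv \<and> (\<forall>k\<in>{1..m}. \<forall>v\<in>\<Omega>v. Vt k v = fixed_fun \<Omega>v f0v e k v)"

(* The coefficient matrix M S N^T of f^n in the augmented bases. *)
definition S_proj ::
  "real^'d \<Rightarrow> real^'d \<Rightarrow> (real^'d) set \<Rightarrow> (real^'d \<Rightarrow> real) \<Rightarrow> nat
     \<Rightarrow> (nat \<Rightarrow> real^'d \<Rightarrow> real) \<Rightarrow> (nat \<Rightarrow> nat \<Rightarrow> real) \<Rightarrow> (nat \<Rightarrow> real^'d \<Rightarrow> real)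
     \<Rightarrow> (nat \<Rightarrow> real^'d \<Rightarrow> real) \<Rightarrow> (nat \<Rightarrow> real^'d \<Rightarrow> real) \<Rightarrow> nat \<Rightarrow> nat \<Rightarrow> real" where
  "S_proj a b \<Omega>v f0v r X S V Xt Vt k l =
     (\<Sum>i=1..r. \<Sum>j=1..r. ip_x a b (Xt k) (X i) * S i j * ip_v \<Omega>v f0v (V j) (Vt l))"

definition S_new ::
  "real^'d \<Rightarrow> real^'d \<Rightarrow> (real^'d) set \<Rightarrow> (real^'d \<Rightarrow> real) \<Rightarrow> real \<Rightarrow> nat
     \<Rightarrow> (nat \<Rightarrow> real^'d \<Rightarrow> real) \<Rightarrow> (nat \<Rightarrow> nat \<Rightarrow> real) \<Rightarrow> (nat \<Rightarrow> real^'d \<Rightarrow> real)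
     \<Rightarrow> nat \<Rightarrow> (nat \<Rightarrow> real^'d \<Rightarrow> real) \<Rightarrow> nat \<Rightarrow> (nat \<Rightarrow> real^'d \<Rightarrow> real)
     \<Rightarrow> nat \<Rightarrow> nat \<Rightarrow> real" where
  "S_new a b \<Omega>v f0v \<tau> r X S V nx Xt nv Vt k l =
     (let S0 = S_proj a b \<Omega>v f0v r X S V Xt Vt; g = lowrank f0v nx nv Xt S0 Vt
      in S0 k l + \<tau> * pair_xv a b \<Omega>v (\<lambda>x v. Xt k x * Vt l v) (RHS a b \<Omega>v g))"

definition truncation ::
  "real^'d \<Rightarrow> real^'d \<Rightarrow> (real^'d) set \<Rightarrow> (real^'d \<Rightarrow> real) \<Rightarrow> (nat \<Rightarrow> 'd) \<Rightarrow> nat \<Rightarrow> nat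
     \<Rightarrow> nat \<Rightarrow> (nat \<Rightarrow> real^'d \<Rightarrow> real) \<Rightarrow> (nat \<Rightarrow> nat \<Rightarrow> real)
     \<Rightarrow> nat \<Rightarrow> (nat \<Rightarrow> real^'d \<Rightarrow> real)
     \<Rightarrow> (nat \<Rightarrow> real^'d \<Rightarrow> real) \<Rightarrow> (nat \<Rightarrow> nat \<Rightarrow> real) \<Rightarrow> (nat \<Rightarrow> real^'d \<Rightarrow> real) \<Rightarrow> bool" where
  "truncation a b \<Omega>v f0v e m r nx Xt St nv Vt X' S' V' \<longleftrightarrow>
     (\<exists>Xcons Scons p Xtrem Strem Uh sh Wh Xrem R.
        let Kt = (\<lambda>l x. \<Sum>k=1..nx. Xt k x * St k l) in
        is_QR_x a b m m Kt Xcons Scons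
        \<and> is_QR_x a b p (nv - m) (\<lambda>l. Kt (m + l)) Xtrem Strem
        \<and> r - m \<le> min p (nv - m)
        \<and> is_SVD p (nv - m) Strem Uh sh Wh
        \<and> (\<forall>l\<in>{1..r-m}. \<forall>x. Xrem l x = (\<Sum>i=1..p. Xtrem i x * Uh i l))
        \<and> (\<forall>k\<in>{1..m}. \<forall>v\<in>\<Omega>v. V' k v = fixed_fun \<Omega>v f0v e k v)
        \<and> (\<forall>l\<in>{1..r-m}. \<forall>v\<in>\<Omega>v. V' (m + l) v = (\<Sum>j=1..nv-m. Vt (m + j) v * Wh j l))
        \<and> is_QR_x a b r r (\<lambda>j. if j \<le> m then Xcons j else Xrem (j - m)) X' R
        \<and> (\<forall>i\<in>{1..r}. \<forall>j\<in>{1..r}. S' i j =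
             (\<Sum>l=1..r. R i l * (if l \<le> m \<and> j \<le> m then Scons l j
                                 else if l > m \<and> l = j then sh (l - m) else 0))))"

definition integrator_step ::
  "real^'d \<Rightarrow> real^'d \<Rightarrow> (real^'d) set \<Rightarrow> (real^'d \<Rightarrow> real) \<Rightarrow> (nat \<Rightarrow> 'd) \<Rightarrow> real \<Rightarrow> nat \<Rightarrow> nat
     \<Rightarrow> (nat \<Rightarrow> real^'d \<Rightarrow> real) \<Rightarrow> (nat \<Rightarrow> nat \<Rightarrow> real) \<Rightarrow> (nat \<Rightarrow> real^'d \<Rightarrow> real)
     \<Rightarrow> (nat \<Rightarrow> real^'d \<Rightarrow> real) \<Rightarrow> (nat \<Rightarrow> nat \<Rightarrow> real) \<Rightarrow> (nat \<Rightarrow> real^'d \<Rightarrow> real) \<Rightarrow> bool" where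
  "integrator_step a b \<Omega>v f0v e \<tau> m r X S V X' S' V' \<longleftrightarrow>
     (\<exists>nx Xt nv Vt.
        augmented_bases a b \<Omega>v f0v e \<tau> m r X S V nx Xt nv Vt
        \<and> truncation a b \<Omega>v f0v e m r nx Xt
            (S_new a b \<Omega>v f0v \<tau> r X S V nx Xt nv Vt) nv Vt X' S' V')"

end

theory Submission
  imports Defs
begin

text \<open>
  The proof rests on the fact that the velocity components \<open>v $ c\<close> are multiples of fixed basis
  functions \<open>U k\<close>, and that the moments against these undergo an explicit Euler step, free of
  projection and truncation errors.

  For \<open>k \<le> m\<close>, the moment of the new solution against \<open>U k\<close> is column \<open>k\<close> of the product of the
  augmented spatial basis and the new coefficient matrix, because the truncation only compresses
  the part orthogonal to the fixed functions (\<open>truncation_moment\<close>).  The augmented bases contain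
  the old factors, so the coefficient step evaluates the right-hand side at the old solution, and
  the spatial basis contains the Euler update \<open>K_new k\<close>, which is therefore reproduced at every
  point (\<open>augmented_column\<close>).  Hence the momentum changes by \<open>\<tau>\<close> times the first velocity
  moment of the right-hand side, and this moment is minus the sum of the divergence of the stress
  and of \<open>\<rho> E\<close> (\<open>velocity_moment_RHS\<close>).

  For the total momentum, the continuity equation is integrated over the box.  The divergence of the
  stress integrates to zero by periodicity.  The density equals one plus the Laplacian of the
  potential, and \<open>\<partial>\<^sub>i \<phi> laplacian \<phi>\<close> is the divergence of a periodic field, so the integral of
  \<open>\<rho> E\<close> vanishes as well (\<open>total_force_zero\<close>).
\<close>

section \<open>Integration over sets and products\<close>

text \<open>
  No measurability is needed here, since the two indicator-weighted integrands are the same function.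
\<close>

lemma set_integral_eqI:
  assumes "\<And>x. x \<in> A \<Longrightarrow> f x = g x"
  shows "(LINT x:A|M. f x) = (LINT x:A|M. g x)"
  unfolding set_lebesgue_integral_def
  by (rule arg_cong[where f = "integral\<^sup>L M"]) (auto simp: fun_eq_iff assms split: split_indicator)

lemma set_integrable_eqI:
  assumes "\<And>x. x \<in> A \<Longrightarrow> f x = g x"
  shows "set_integrable M A f \<longleftrightarrow> set_integrable M A g"
  unfolding set_integrable_def
  by (rule arg_cong[where f = "integrable M"]) (auto simp: fun_eq_iff assms split: split_indicator)

lemma set_integral_finite_sum:
  fixes f :: "'i \<Rightarrow> 'a \<Rightarrow> 'b::{banach,second_countable_topology}"
  assumes "\<And>i. i \<in> I \<Longrightarrow> set_integrable M A (f i)"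
  shows "set_integrable M A (\<lambda>x. \<Sum>i\<in>I. f i x)"
    and "(LINT x:A|M. (\<Sum>i\<in>I. f i x)) = (\<Sum>i\<in>I. LINT x:A|M. f i x)"
  using assms unfolding set_integrable_def set_lebesgue_integral_def
  by (simp_all add: scaleR_sum_right)

lemma set_integral_vec_nth:
  fixes f :: "'a \<Rightarrow> 'b::euclidean_space^'n"
  assumes "\<And>i. set_integrable M A (\<lambda>x. f x $ i)"
  shows "set_integrable M A f"
    and "(LINT x:A|M. f x) $ i = (LINT x:A|M. f x $ i)"
proof -
  have ax: "bounded_linear (\<lambda>y::'b. axis i y)" for i :: 'n
  proof (rule bounded_linear_intro[where K = 1])
    show "norm (axis i y) \<le> norm y * 1" for y :: 'b
      using inner_axis_axis[of i y i y] by (simp add: norm_eq_sqrt_inner)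
  qed (auto simp: axis_def vec_eq_iff)
  have *: "indicator A x *\<^sub>R f x = (\<Sum>i\<in>UNIV. axis i (indicator A x *\<^sub>R f x $ i))" for x
    by (simp add: vec_eq_iff axis_def if_distrib cong: if_cong)
  have "integrable M (\<lambda>x. \<Sum>i\<in>UNIV. axis i (indicator A x *\<^sub>R f x $ i))"
    by (intro Bochner_Integration.integrable_sum integrable_bounded_linear[OF ax])
      (use assms in \<open>simp add: set_integrable_def\<close>)
  then show 1: "set_integrable M A f"
    unfolding set_integrable_def by (subst *)
  show "(LINT x:A|M. f x) $ i = (LINT x:A|M. f x $ i)"
    using integral_bounded_linear[OF bounded_linear_vec_nth, of M "\<lambda>x. indicator A x *\<^sub>R f x" i] 1
    by (simp add: set_lebesgue_integral_def set_integrable_def)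
qed

lemma set_integrable_prod:
  fixes f :: "'a::euclidean_space \<Rightarrow> real" and g :: "'b::euclidean_space \<Rightarrow> real"
  assumes f: "set_integrable lborel A f" and g: "set_integrable lborel B g"
  shows "set_integrable lborel (A \<times> B) (\<lambda>z. f (fst z) * g (snd z))"
proof -
  let ?f = "\<lambda>x. indicator A x *\<^sub>R f x" and ?g = "\<lambda>x. indicator B x *\<^sub>R g x"
  have f': "integrable lborel ?f" and g': "integrable lborel ?g"
    using f g by (auto simp: set_integrable_def)
  note [measurable] = borel_measurable_integrable[OF f'] borel_measurable_integrable[OF g']
  have "integrable (lborel \<Otimes>\<^sub>M lborel) (\<lambda>z. ?f (fst z) * ?g (snd z))"
  proof (rule lborel_pair.Fubini_integrable)
    show "(\<lambda>z. ?f (fst z) * ?g (snd z)) \<in> borel_measurable (lborel \<Otimes>\<^sub>M lborel)"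
      by measurable
    show "integrable lborel (\<lambda>x. \<integral>y. norm (?f (fst (x, y)) * ?g (snd (x, y))) \<partial>lborel)"
      using integrable_mult_left[OF integrable_norm[OF f'], of "\<integral>y. norm (?g y) \<partial>lborel"]
      by (simp add: abs_mult)
    show "AE x in lborel. integrable lborel (\<lambda>y. ?f (fst (x, y)) * ?g (snd (x, y)))"
      using g' by simp
  qed
  moreover have "(\<lambda>z. ?f (fst z) * ?g (snd z))
      = (\<lambda>z. indicator (A \<times> B) z *\<^sub>R (f (fst z) * g (snd z)))"
    by (auto simp: fun_eq_iff indicator_def)
  ultimately show ?thesis
    by (simp add: lborel_prod set_integrable_def)
qed

lemma set_integral_Fubini:
  fixes h :: "'a::euclidean_space \<Rightarrow> 'b::euclidean_space \<Rightarrow> real"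
  assumes "set_integrable lborel (A \<times> B) (\<lambda>z. h (fst z) (snd z))"
  shows "(LINT z:A \<times> B|lborel. h (fst z) (snd z)) = (LINT x:A|lborel. LINT y:B|lborel. h x y)"
proof -
  let ?k = "\<lambda>z. indicator (A \<times> B) z *\<^sub>R h (fst z) (snd z)"
  have "integrable (lborel \<Otimes>\<^sub>M lborel) ?k"
    using assms by (simp add: set_integrable_def lborel_prod)
  from lborel_pair.integral_fst'[OF this]
  have "integral\<^sup>L lborel ?k = (\<integral>x. \<integral>y. ?k (x, y) \<partial>lborel \<partial>lborel)"
    by (simp add: lborel_prod)
  also have "(\<lambda>x. \<integral>y. ?k (x, y) \<partial>lborel)
      = (\<lambda>x. indicator A x *\<^sub>R (\<integral>y. indicator B y *\<^sub>R h x y \<partial>lborel))"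
    by (auto simp: fun_eq_iff indicator_def)
  finally show ?thesis
    by (simp add: set_lebesgue_integral_def)
qed

section \<open>Weighted square-integrable functions and orthonormal families\<close>

text \<open>
  The products of square-integrable functions are integrable; the bound
  \<open>\<bar>u w\<bar> \<le> u\<^sup>2 + w\<^sup>2\<close> replaces the Cauchy--Schwarz inequality.
\<close>

lemma L2_v_mult_integrable:
  assumes g: "set_borel_measurable lborel A g" "\<And>v. v \<in> A \<Longrightarrow> 0 \<le> g v"
    and u: "L2_v A g u" and w: "L2_v A g w"
  shows "set_integrable lborel A (\<lambda>v. g v * (u v * w v))"
proof -
  have "set_integrable lborel A (\<lambda>v. g v * (u v)\<^sup>2 + g v * (w v)\<^sup>2)"
    using u w by (auto simp: L2_v_def intro: set_integral_add)
  then have int: "integrable lborel (\<lambda>v. indicator A v *\<^sub>R (g v * (u v)\<^sup>2 + g v * (w v)\<^sup>2))"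
    by (simp add: set_integrable_def)
  have [measurable]: "(\<lambda>v. indicator A v *\<^sub>R g v) \<in> borel_measurable lborel"
     "(\<lambda>v. indicator A v *\<^sub>R u v) \<in> borel_measurable lborel"
     "(\<lambda>v. indicator A v *\<^sub>R w v) \<in> borel_measurable lborel"
    using g u w by (auto simp: L2_v_def set_borel_measurable_def)
  have "(\<lambda>v. (indicator A v *\<^sub>R g v) * ((indicator A v *\<^sub>R u v) * (indicator A v *\<^sub>R w v)))
      \<in> borel_measurable lborel"
    by measurable
  also have "(\<lambda>v. (indicator A v *\<^sub>R g v) * ((indicator A v *\<^sub>R u v) * (indicator A v *\<^sub>R w v)))
      = (\<lambda>v. indicator A v *\<^sub>R (g v * (u v * w v)))"
    by (auto simp: fun_eq_iff indicator_def)
  finally have m: "(\<lambda>v. indicator A v *\<^sub>R (g v * (u v * w v))) \<in> borel_measurable lborel" .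
  have b: "norm (indicator A v *\<^sub>R (g v * (u v * w v)))
      \<le> norm (indicator A v *\<^sub>R (g v * (u v)\<^sup>2 + g v * (w v)\<^sup>2))" for v
  proof (cases "v \<in> A")
    case True
    have "\<bar>u v * w v\<bar> \<le> (u v)\<^sup>2 + (w v)\<^sup>2"
      using sum_squares_bound[of "\<bar>u v\<bar>" "\<bar>w v\<bar>"]
        mult_nonneg_nonneg[of "\<bar>u v\<bar>" "\<bar>w v\<bar>"]
      unfolding abs_mult power2_abs mult.assoc by linarith
    then have "g v * \<bar>u v * w v\<bar> \<le> g v * ((u v)\<^sup>2 + (w v)\<^sup>2)"
      using g(2)[OF True] by (rule mult_left_mono)
    then show ?thesis
      using True g(2)[OF True] by (simp add: abs_mult algebra_simps)
  qed auto
  show ?thesis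
    unfolding set_integrable_def
    by (rule Bochner_Integration.integrable_bound[OF int m]) (use b in auto)
qed

lemma ip_v_cong:
  assumes "\<And>v. v \<in> A \<Longrightarrow> u v = u' v" "\<And>v. v \<in> A \<Longrightarrow> w v = w' v"
  shows "ip_v A g u w = ip_v A g u' w'"
  unfolding ip_v_def by (rule set_integral_eqI) (simp add: assms)

lemma ip_v_commute: "ip_v A g u w = ip_v A g w u"
  by (simp add: ip_v_def mult.commute)

text \<open>
  The spatial inner product is the weighted one for the box with weight 1, so the following facts
  about weighted inner products serve both variables.
\<close>

lemma ip_x_eq_ip_v: "ip_x a b u w = ip_v (cbox a b) (\<lambda>_. 1) u w"
  by (simp add: ip_x_def ip_v_def)

lemma L2_x_imp_L2_v: "L2_x a b u \<Longrightarrow> L2_v (cbox a b) (\<lambda>_. 1) u"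
  by (auto simp: L2_x_def L2_v_def set_borel_measurable_def)

lemma orthonormal_x_imp_orthonormal_v:
  "orthonormal_x a b n Q \<Longrightarrow> orthonormal_v (cbox a b) (\<lambda>_. 1) n Q"
  by (auto simp: orthonormal_x_def orthonormal_v_def ip_x_eq_ip_v L2_x_imp_L2_v)

lemma set_borel_measurable_const_cbox: "set_borel_measurable lborel (cbox a b) (\<lambda>_. 1::real)"
  by (simp add: set_borel_measurable_def)

lemma L2_x_mult_integrable:
  assumes "L2_x a b u" "L2_x a b w"
  shows "set_integrable lborel (cbox a b) (\<lambda>x. u x * w x)"
  using L2_v_mult_integrable[OF set_borel_measurable_const_cbox _ assms[THEN L2_x_imp_L2_v]]
  by simp

lemma L2_v_continuous:
  assumes "continuous_on (cbox a b) w"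
  shows "L2_v (cbox a b) (\<lambda>_. 1) w"
  unfolding L2_v_def set_borel_measurable_def set_integrable_def
  using borel_integrable_compact[OF compact_cbox assms]
    borel_integrable_compact[OF compact_cbox, of a b "\<lambda>x. (w x)\<^sup>2"]
  by (auto intro!: continuous_intros assms borel_measurable_integrable)

lemma L2_x_mult_continuous_integrable:
  assumes "L2_x a b u" "continuous_on (cbox a b) w"
  shows "set_integrable lborel (cbox a b) (\<lambda>x. u x * w x)"
  using L2_v_mult_integrable[OF set_borel_measurable_const_cbox _ L2_x_imp_L2_v[OF assms(1)]
      L2_v_continuous[OF assms(2)]]
  by simp

lemma L2_x_integrable: "L2_x a b u \<Longrightarrow> set_integrable lborel (cbox a b) u"
  using L2_x_mult_continuous_integrable[of a b u "\<lambda>_. 1"] by simp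

text \<open>
  Integration takes place over \<open>A\<close>, while the expansion holds at every point of the possibly
  larger set \<open>D\<close> on which \<open>h\<close> is a combination of the \<open>Q k\<close>: for spatial functions \<open>A\<close> is
  the box and \<open>D\<close> the whole space.
\<close>

lemma orthonormal_expansion:
  assumes g: "set_borel_measurable lborel A g" "\<And>v. v \<in> A \<Longrightarrow> 0 \<le> g v"
    and Q: "orthonormal_v A g n Q" and "A \<subseteq> D"
    and h: "h \<in> span_on D (Q ` {1..n})" and "v \<in> D"
  shows "h v = (\<Sum>k=1..n. ip_v A g (Q k) h * Q k v)"
proof -
  obtain T c where T: "finite T" "T \<subseteq> Q ` {1..n}"
    and hT: "\<And>x. x \<in> D \<Longrightarrow> h x = (\<Sum>u\<in>T. c u * u x)"
    using h by (auto simp: span_on_def)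
  have int: "set_integrable lborel A (\<lambda>v. g v * (Q k v * u v))" if "u \<in> T" "k \<in> {1..n}" for u k
    using that T(2) Q by (auto simp: orthonormal_v_def intro!: L2_v_mult_integrable[OF g])
  have ip: "ip_v A g (Q k) h = (\<Sum>u\<in>T. c u * ip_v A g (Q k) u)" if k: "k \<in> {1..n}" for k
  proof -
    have "ip_v A g (Q k) h = (LINT v:A|lborel. \<Sum>u\<in>T. c u * (g v * (Q k v * u v)))"
      unfolding ip_v_def using \<open>A \<subseteq> D\<close>
      by (intro set_integral_eqI)
        (auto simp: hT[OF subsetD] sum_distrib_left sum_distrib_right mult_ac)
    also have "\<dots> = (\<Sum>u\<in>T. c u * ip_v A g (Q k) u)"
      using int[OF _ k] by (subst set_integral_finite_sum(2)) (auto simp: ip_v_def)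
    finally show ?thesis .
  qed
  have elem: "(\<Sum>k=1..n. ip_v A g (Q k) u * Q k v) = u v" if "u \<in> T" for u
  proof -
    obtain l where l: "l \<in> {1..n}" "u = Q l"
      using T(2) \<open>u \<in> T\<close> by auto
    have "(\<Sum>k=1..n. ip_v A g (Q k) u * Q k v) = (\<Sum>k=1..n. if k = l then Q l v else 0)"
      using Q l by (intro sum.cong) (auto simp: orthonormal_v_def)
    then show ?thesis
      using l by simp
  qed
  have "(\<Sum>k=1..n. ip_v A g (Q k) h * Q k v)
      = (\<Sum>u\<in>T. c u * (\<Sum>k=1..n. ip_v A g (Q k) u * Q k v))"
    by (subst sum_distrib_left, subst sum.swap)
      (simp add: ip sum_distrib_left sum_distrib_right mult_ac)
  also have "\<dots> = h v"
    using \<open>v \<in> D\<close> by (simp add: elem hT del: One_nat_def)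
  finally show ?thesis ..
qed

lemma span_on_superset: "u \<in> F \<Longrightarrow> u \<in> span_on D F"
  unfolding span_on_def by (intro CollectI exI[of _ "{u}"] exI[of _ "\<lambda>_. 1"]) simp

section \<open>Partial derivatives\<close>

lemma has_derivative_imp_along_axis:
  assumes "(h has_derivative h') (at (x + s *\<^sub>R axis i 1))"
  shows "((\<lambda>s. h (x + s *\<^sub>R axis i 1)) has_field_derivative h' (axis i 1)) (at s)"
proof -
  have "((\<lambda>s. x + s *\<^sub>R axis i 1) has_derivative (\<lambda>t. t *\<^sub>R axis i 1)) (at s)"
    by (auto intro!: derivative_eq_intros)
  from has_derivative_compose[OF this assms]
  have "((\<lambda>s. h (x + s *\<^sub>R axis i 1)) has_derivative (\<lambda>t. h' (t *\<^sub>R axis i 1))) (at s)" .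
  also have "(\<lambda>t. h' (t *\<^sub>R axis i 1)) = (*) (h' (axis i 1))"
    using has_derivative_linear[OF assms] by (auto simp: fun_eq_iff linear_scale mult.commute)
  finally show ?thesis
    by (simp add: has_field_derivative_def)
qed

lemma partial_eqI:
  assumes "(h has_derivative h') (at x)"
  shows "partial i h x = h' (axis i 1)"
  unfolding partial_def
  by (rule DERIV_imp_deriv, rule has_derivative_imp_along_axis) (simp add: assms)

lemma has_partial_along_axis:
  assumes "h differentiable at (x + s *\<^sub>R axis i 1)"
  shows "((\<lambda>s. h (x + s *\<^sub>R axis i 1)) has_field_derivative
           partial i h (x + s *\<^sub>R axis i 1)) (at s)"
proof -
  obtain h' where h': "(h has_derivative h') (at (x + s *\<^sub>R axis i 1))"
    using assms by (auto simp: differentiable_def)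
  show ?thesis
    unfolding partial_eqI[OF h'] by (rule has_derivative_imp_along_axis[OF h'])
qed

lemma partial_weighted_sum:
  assumes "\<And>k. k \<in> I \<Longrightarrow> h k differentiable at x"
  shows "partial i (\<lambda>y. \<Sum>k\<in>I. c k * h k y) x = (\<Sum>k\<in>I. c k * partial i (h k) x)"
proof -
  have "\<forall>k. \<exists>D. k \<in> I \<longrightarrow> (h k has_derivative D) (at x)"
    using assms by (auto simp: differentiable_def)
  then obtain D where D: "\<And>k. k \<in> I \<Longrightarrow> (h k has_derivative D k) (at x)"
    by metis
  have "((\<lambda>y. \<Sum>k\<in>I. c k * h k y) has_derivative (\<lambda>z. \<Sum>k\<in>I. c k * D k z)) (at x)"
    by (intro has_derivative_sum has_derivative_mult_right D)
  from partial_eqI[OF this] show ?thesis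
    by (simp add: partial_eqI[OF D])
qed

lemma partial_times:
  assumes "h differentiable at x" "k differentiable at x"
  shows "partial i (\<lambda>y. h y * k y) x = partial i h x * k x + h x * partial i k x"
proof -
  obtain H K where D: "(h has_derivative H) (at x)" "(k has_derivative K) (at x)"
    using assms by (auto simp: differentiable_def)
  from partial_eqI[OF has_derivative_mult[OF D]] show ?thesis
    by (simp add: partial_eqI[OF D(1)] partial_eqI[OF D(2)])
qed

lemma partial_cong_open:
  assumes "open D" "x \<in> D" "\<And>y. y \<in> D \<Longrightarrow> h y = k y"
  shows "partial i h x = partial i k x"
proof -
  have "((\<lambda>s. x + s *\<^sub>R axis i 1) \<longlongrightarrow> x + 0 *\<^sub>R axis i 1) (nhds (0::real))"
    by (intro tendsto_intros filterlim_ident)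
  then have "\<forall>\<^sub>F s in nhds 0. x + s *\<^sub>R axis i 1 \<in> D"
    using assms(1,2) by (auto dest: topological_tendstoD)
  then show ?thesis
    unfolding partial_def
    by (intro deriv_cong_ev) (auto elim!: eventually_mono simp: assms(3))
qed

lemma C1_on_UNIV_differentiable: "C1_on UNIV h \<Longrightarrow> h differentiable at x"
  by (simp add: C1_on_def differentiable_on_def)

lemma C1_on_UNIV_continuous: "C1_on UNIV h \<Longrightarrow> continuous_on S h"
  using continuous_on_subset[OF differentiable_imp_continuous_on] by (auto simp: C1_on_def)

lemma C1_on_UNIV_continuous_partial: "C1_on UNIV h \<Longrightarrow> continuous_on S (partial i h)"
  using continuous_on_subset by (auto simp: C1_on_def)

lemma C1_on_UNIV_mult:
  assumes "C1_on UNIV h" "C1_on UNIV k"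
  shows "C1_on UNIV (\<lambda>x. h x * k x)"
  unfolding C1_on_def
proof (intro conjI allI)
  show "(\<lambda>x. h x * k x) differentiable_on UNIV"
    using assms by (auto simp: C1_on_def differentiable_on_def intro: differentiable_mult)
  have "partial i (\<lambda>y. h y * k y) = (\<lambda>x. partial i h x * k x + h x * partial i k x)" for i
    by (intro ext partial_times C1_on_UNIV_differentiable assms)
  then show "continuous_on UNIV (partial i (\<lambda>y. h y * k y))" for i
    by (simp only:) (intro continuous_on_add continuous_on_mult
        C1_on_UNIV_continuous[OF assms(1)] C1_on_UNIV_continuous[OF assms(2)]
        C1_on_UNIV_continuous_partial[OF assms(1)] C1_on_UNIV_continuous_partial[OF assms(2)])
qed

text \<open>
  The symmetry of second derivatives.  The increment of \<open>\<phi>\<close> in direction \<open>j\<close> is an integral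
  of \<open>partial j \<phi>\<close>; differentiating it in direction \<open>i\<close> under the integral sign and then in its
  upper limit gives both mixed derivatives.
\<close>

lemma second_partials_commute:
  assumes "C2_on UNIV \<phi>"
  shows "partial j (partial i \<phi>) x = partial i (partial j \<phi>) x"
proof -
  let ?ei = "axis i (1::real)" and ?ej = "axis j (1::real)"
  have C1: "C1_on UNIV \<phi>" "C1_on UNIV (partial i \<phi>)" "C1_on UNIV (partial j \<phi>)"
    using assms by (auto simp: C2_on_def)
  let ?G = "\<lambda>u t. partial j \<phi> ((x + u *\<^sub>R ?ei) + t *\<^sub>R ?ej)"
  have inc: "integral (cbox 0 s) (?G u)
      = \<phi> (x + s *\<^sub>R ?ej + u *\<^sub>R ?ei) - \<phi> (x + u *\<^sub>R ?ei)" if "0 \<le> s" for s u :: real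
  proof -
    have "(?G u has_integral \<phi> (x + u *\<^sub>R ?ei + s *\<^sub>R ?ej) - \<phi> (x + u *\<^sub>R ?ei + 0 *\<^sub>R ?ej)) {0..s}"
    proof (rule fundamental_theorem_of_calculus[OF that])
      show "((\<lambda>t. \<phi> (x + u *\<^sub>R ?ei + t *\<^sub>R ?ej)) has_vector_derivative ?G u t) (at t within {0..s})" for t
        unfolding has_real_derivative_iff_has_vector_derivative[symmetric]
        by (rule has_field_derivative_at_within[OF
              has_partial_along_axis[OF C1_on_UNIV_differentiable[OF C1(1)]]])
    qed
    then show ?thesis
      by (simp add: integral_unique add_ac)
  qed
  have inc': "partial i \<phi> (x + s *\<^sub>R ?ej) - partial i \<phi> x
      = integral {0..s} (\<lambda>t. partial i (partial j \<phi>) (x + t *\<^sub>R ?ej))" if "0 \<le> s" for s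
  proof -
    have "((\<lambda>u. integral (cbox 0 s) (?G u)) has_field_derivative
        integral (cbox 0 s) (\<lambda>t. partial i (partial j \<phi>) ((x + t *\<^sub>R ?ej) + 0 *\<^sub>R ?ei))) (at 0 within UNIV)"
    proof (rule leibniz_rule_field_derivative)
      fix u t :: real
      have eq: "?G u t = partial j \<phi> ((x + t *\<^sub>R ?ej) + u *\<^sub>R ?ei)" for u t
        by (simp add: add_ac)
      show "((\<lambda>u. ?G u t) has_field_derivative
          partial i (partial j \<phi>) ((x + t *\<^sub>R ?ej) + u *\<^sub>R ?ei)) (at u)"
        unfolding eq by (rule has_partial_along_axis[OF C1_on_UNIV_differentiable[OF C1(3)]])
      show "?G u integrable_on cbox 0 s"
        by (intro integrable_continuous continuous_on_compose2[OF C1_on_UNIV_continuous[OF C1(3)]]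
            continuous_intros) auto
      show "continuous_on (UNIV \<times> cbox 0 s)
          (\<lambda>(u, t). partial i (partial j \<phi>) ((x + t *\<^sub>R ?ej) + u *\<^sub>R ?ei))"
        unfolding split_beta
        by (intro continuous_on_compose2[OF C1_on_UNIV_continuous_partial[OF C1(3)]]
            continuous_intros) auto
    qed auto
    from this[simplified]
    have 1: "((\<lambda>u. integral (cbox 0 s) (?G u)) has_field_derivative
        integral {0..s} (\<lambda>t. partial i (partial j \<phi>) (x + t *\<^sub>R ?ej))) (at 0)"
      by (simp add: cbox_interval)
    have "((\<lambda>u. integral (cbox 0 s) (?G u)) has_field_derivative
        partial i \<phi> (x + s *\<^sub>R ?ej + 0 *\<^sub>R ?ei) - partial i \<phi> (x + 0 *\<^sub>R ?ei)) (at 0 within UNIV)"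
      unfolding inc[OF that]
      by (intro DERIV_diff has_partial_along_axis[OF C1_on_UNIV_differentiable[OF C1(1)]])
    then have 2: "((\<lambda>u. integral (cbox 0 s) (?G u)) has_field_derivative
        partial i \<phi> (x + s *\<^sub>R ?ej) - partial i \<phi> x) (at 0)"
      by simp
    show ?thesis
      by (rule DERIV_unique[OF 2 1])
  qed
  let ?P = "\<lambda>t. partial i (partial j \<phi>) (x + t *\<^sub>R ?ej)"
  have "((\<lambda>s. integral {0..s} ?P) has_real_derivative ?P 0) (at 0 within {0..1})"
    by (intro integral_has_real_derivative
        continuous_on_compose2[OF C1_on_UNIV_continuous_partial[OF C1(3)]] continuous_intros) auto
  then have 1: "((\<lambda>s. integral {0..s} ?P) has_vector_derivative ?P 0) (at 0 within {0..1})"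
    by (simp add: has_real_derivative_iff_has_vector_derivative)
  have "((\<lambda>s. partial i \<phi> (x + s *\<^sub>R ?ej) - partial i \<phi> x) has_real_derivative
      partial j (partial i \<phi>) (x + 0 *\<^sub>R ?ej) - 0) (at 0 within {0..1})"
    by (rule DERIV_subset[of _ _ _ UNIV])
      (intro DERIV_diff DERIV_const has_partial_along_axis[OF C1_on_UNIV_differentiable[OF C1(2)]],
        simp)
  then have "((\<lambda>s. integral {0..s} ?P) has_real_derivative partial j (partial i \<phi>) x)
      (at 0 within {0..1})"
    using has_field_derivative_transform_within[of _ _ 0 "{0..1}" 1 "\<lambda>s. integral {0..s} ?P"] inc'
    by fastforce
  then have 2: "((\<lambda>s. integral {0..s} ?P) has_vector_derivative partial j (partial i \<phi>) x)
      (at 0 within {0..1})"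
    by (simp add: has_real_derivative_iff_has_vector_derivative)
  show ?thesis
    using vector_derivative_unique_within_closed_interval[of 0 1 0, OF _ _ 2[folded cbox_interval] 1[folded cbox_interval]]
    by simp
qed

section \<open>Integrals over a period cell\<close>

lemma periodicD: "periodic a b h \<Longrightarrow> h (x + (b $ i - a $ i) *\<^sub>R axis i 1) = h x"
  by (simp add: periodic_def)

lemma periodic_partial:
  assumes "periodic a b h"
  shows "periodic a b (partial j h)"
  unfolding periodic_def
proof (intro allI)
  fix x i
  have "(\<lambda>s. h (x + (b $ i - a $ i) *\<^sub>R axis i 1 + s *\<^sub>R axis j 1)) = (\<lambda>s. h (x + s *\<^sub>R axis j 1))"
  proof
    fix s
    show "h (x + (b $ i - a $ i) *\<^sub>R axis i 1 + s *\<^sub>R axis j 1) = h (x + s *\<^sub>R axis j 1)"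
      using periodicD[OF assms, of "x + s *\<^sub>R axis j 1" i] by (simp add: add_ac)
  qed
  then show "partial j h (x + (b $ i - a $ i) *\<^sub>R axis i 1) = partial j h x"
    by (simp add: partial_def)
qed

text \<open>
  The shifted box is obtained by cutting a slab off one side of the box and adding its translate
  by one period on the other side.
\<close>

lemma integral_cbox_shift_periodic:
  fixes g :: "real^'d \<Rightarrow> real"
  assumes ab: "\<And>i. a $ i < b $ i" and cont: "continuous_on UNIV g" and per: "periodic a b g"
    and s: "0 \<le> s" "s \<le> b $ i - a $ i"
  shows "integral (cbox a b) (\<lambda>x. g (x + s *\<^sub>R axis i 1)) = integral (cbox a b) g"
proof -
  define p where "p = b $ i - a $ i"
  define C where "C = (\<lambda>u w. cbox (a + u *\<^sub>R axis i (1::real)) (b + w *\<^sub>R axis i 1))"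
  have mem: "x \<in> C u w \<longleftrightarrow> (\<forall>j. j \<noteq> i \<longrightarrow> a $ j \<le> x $ j \<and> x $ j \<le> b $ j)
      \<and> a $ i + u \<le> x $ i \<and> x $ i \<le> b $ i + w" for x u w
    unfolding C_def mem_box_cart by (auto simp: axis_def split: if_splits)
  have shift: "integral (C (u + t) (w + t)) g = integral (C u w) (\<lambda>x. g (x + t *\<^sub>R axis i 1))"
    for u w t
    using integral_shift_cbox[of "a + (u + t) *\<^sub>R axis i 1" "t *\<^sub>R axis i 1" "b + (w + t) *\<^sub>R axis i 1" g]
    by (simp add: C_def algebra_simps)
  have "g integrable_on C 0 s"
    unfolding C_def by (intro integrable_continuous continuous_on_subset[OF cont]) auto
  then have split: "integral (C 0 s) g = integral (C 0 s \<inter> {x. x \<bullet> axis i 1 \<le> c}) g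
      + integral (C 0 s \<inter> {x. x \<bullet> axis i 1 \<ge> c}) g" for c
    unfolding C_def by (rule integral_split) (simp add: axis_in_Basis_iff)
  have "C 0 s \<inter> {x. x \<bullet> axis i 1 \<le> b $ i} = C 0 0" "C 0 s \<inter> {x. x \<bullet> axis i 1 \<ge> b $ i} = C p s"
    "C 0 s \<inter> {x. x \<bullet> axis i 1 \<le> a $ i + s} = C 0 (s - p)"
    "C 0 s \<inter> {x. x \<bullet> axis i 1 \<ge> a $ i + s} = C s s"
    using s ab[of i] by (auto simp: mem inner_axis p_def)
  with split[of "b $ i"] split[of "a $ i + s"]
  have "integral (C 0 0) g + integral (C p s) g = integral (C 0 (s - p)) g + integral (C s s) g"
    by simp
  moreover have "integral (C p s) g = integral (C 0 (s - p)) g"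
    using shift[of 0 p "s - p"] periodicD[OF per, of _ i] by (simp add: p_def)
  ultimately have "integral (C s s) g = integral (C 0 0) g"
    by simp
  then show ?thesis
    using shift[of 0 s 0] by (simp add: C_def)
qed

lemma set_integrable_continuous_cbox:
  fixes g :: "real^'d \<Rightarrow> real"
  shows "continuous_on (cbox a b) g \<Longrightarrow> set_integrable lborel (cbox a b) g"
  unfolding set_integrable_def by (intro borel_integrable_compact compact_cbox)

text \<open>
  The integral over the box of \<open>h\<close> shifted by \<open>s\<close> in direction \<open>i\<close> is the same for all \<open>s\<close> between 0
  and the period, and its one-sided derivative at \<open>s = 0\<close> is the integral of the partial derivative.
\<close>

lemma integral_partial_periodic:
  assumes ab: "\<And>i. a $ i < b $ i" and h: "C1_on UNIV h" and per: "periodic a b h"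
  shows "(LINT x:cbox a b|lborel. partial i h x) = 0"
proof -
  let ?e = "axis i (1::real)"
  let ?p = "b $ i - a $ i"
  let ?I = "\<lambda>s. integral (cbox a b) (\<lambda>x. h (x + s *\<^sub>R ?e))"
  have "(?I has_field_derivative integral (cbox a b) (\<lambda>x. partial i h (x + 0 *\<^sub>R ?e)))
      (at 0 within {0..?p})"
  proof (rule leibniz_rule_field_derivative)
    fix s :: real and x
    show "((\<lambda>s. h (x + s *\<^sub>R ?e)) has_field_derivative partial i h (x + s *\<^sub>R ?e))
        (at s within {0..?p})"
      by (rule DERIV_subset[OF has_partial_along_axis[OF C1_on_UNIV_differentiable[OF h]]]) simp
    show "(\<lambda>x. h (x + s *\<^sub>R ?e)) integrable_on cbox a b"
      by (intro integrable_continuous continuous_on_compose2[OF C1_on_UNIV_continuous[OF h]]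
          continuous_intros) auto
    show "continuous_on ({0..?p} \<times> cbox a b) (\<lambda>(s, x). partial i h (x + s *\<^sub>R ?e))"
      unfolding split_beta
      by (intro continuous_on_compose2[OF C1_on_UNIV_continuous_partial[OF h]] continuous_intros) auto
  qed (use ab[of i] in auto)
  then have 1: "(?I has_vector_derivative integral (cbox a b) (partial i h)) (at 0 within cbox 0 ?p)"
    by (simp add: has_real_derivative_iff_has_vector_derivative)
  have "((\<lambda>_. integral (cbox a b) h) has_vector_derivative 0) (at 0 within cbox 0 ?p)"
    by (rule has_vector_derivative_const)
  then have 2: "(?I has_vector_derivative 0) (at 0 within cbox 0 ?p)"
  proof (rule has_vector_derivative_transform[rotated 2])
    show "0 \<in> cbox 0 ?p"
      using ab[of i] by simp
    show "?I s = integral (cbox a b) h" if "s \<in> cbox 0 ?p" for s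
      using that by (intro integral_cbox_shift_periodic[OF ab C1_on_UNIV_continuous[OF h] per]) auto
  qed
  have "integral (cbox a b) (partial i h) = 0"
    using vector_derivative_unique_within_closed_interval[OF _ _ 1 2] ab[of i] by simp
  then show ?thesis
    using set_borel_integral_eq_integral(2)[OF set_integrable_continuous_cbox[OF C1_on_UNIV_continuous_partial[OF h]]]
    by simp
qed

text \<open>
  For every \<open>j\<close>,
  \<open>\<partial>\<^sub>i \<phi> \<partial>\<^sub>j \<partial>\<^sub>j \<phi> = \<partial>\<^sub>j (\<partial>\<^sub>i \<phi> \<partial>\<^sub>j \<phi>) - 1/2 \<partial>\<^sub>i ((\<partial>\<^sub>j \<phi>)\<^sup>2)\<close>,
  and the derivatives of periodic functions integrate to zero.  Summed over \<open>j\<close>, the right-hand side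
  is the divergence of the Maxwell stress of the potential.
\<close>

lemma integral_partial_laplacian_periodic:
  assumes ab: "\<And>i. a $ i < b $ i" and C2: "C2_on UNIV \<phi>" and per: "periodic a b \<phi>"
  shows "(LINT x:cbox a b|lborel. partial i \<phi> x * laplacian \<phi> x) = 0"
proof -
  have C1: "C1_on UNIV \<phi>" "\<And>j. C1_on UNIV (partial j \<phi>)"
    using C2 by (auto simp: C2_on_def)
  let ?P = "\<lambda>j x. partial i \<phi> x * partial j \<phi> x" and ?Q = "\<lambda>j x. partial j \<phi> x * partial j \<phi> x"
  have PQ: "C1_on UNIV (?P j)" "periodic a b (?P j)" "C1_on UNIV (?Q j)" "periodic a b (?Q j)" for j
    using periodic_partial[OF per] by (auto intro!: C1_on_UNIV_mult C1 simp: periodic_def)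
  have eq: "partial i \<phi> x * laplacian \<phi> x
      = (\<Sum>j\<in>UNIV. partial j (?P j) x - 1/2 * partial i (?Q j) x)" for x
  proof -
    have "partial i \<phi> x * partial j (partial j \<phi>) x = partial j (?P j) x - 1/2 * partial i (?Q j) x" for j
    proof -
      have "partial j (?P j) x
          = partial i (partial j \<phi>) x * partial j \<phi> x + partial i \<phi> x * partial j (partial j \<phi>) x"
        using partial_times[of "partial i \<phi>" x "partial j \<phi>" j, OF C1(2)[THEN C1_on_UNIV_differentiable] C1(2)[THEN C1_on_UNIV_differentiable]]
        by (simp only: second_partials_commute[OF C2, where j = j and i = i])
      moreover have "partial i (?Q j) x = 2 * (partial i (partial j \<phi>) x * partial j \<phi> x)"
        using partial_times[of "partial j \<phi>" x "partial j \<phi>" i, OF C1(2)[THEN C1_on_UNIV_differentiable] C1(2)[THEN C1_on_UNIV_differentiable]]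
        by simp
      ultimately show ?thesis
        by simp
    qed
    then show ?thesis
      unfolding laplacian_def sum_distrib_left by (intro sum.cong refl)
  qed
  have int: "set_integrable lborel (cbox a b) (partial j (?P j))"
    "set_integrable lborel (cbox a b) (\<lambda>x. 1/2 * partial i (?Q j) x)" for j
    by (auto intro!: set_integrable_continuous_cbox C1_on_UNIV_continuous_partial PQ continuous_intros)
  have zero: "(LINT x:cbox a b|lborel. partial j (?P j) x - 1/2 * partial i (?Q j) x) = 0" for j
    using integral_partial_periodic[OF ab PQ(1,2), of j j] integral_partial_periodic[OF ab PQ(3,4), of i j]
      set_integral_diff(2)[OF int] by simp
  show ?thesis
    unfolding eq
    by (subst set_integral_finite_sum(2))
      (rule set_integral_diff(1)[OF int], simp only: zero sum.neutral_const)
qed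

section \<open>The electric field and the right-hand side\<close>

lemma rho_cong:
  "(\<And>v. v \<in> \<Omega>v \<Longrightarrow> f x v = g x v) \<Longrightarrow> rho \<Omega>v f x = rho \<Omega>v g x"
  unfolding rho_def by (rule set_integral_eqI)

lemma E_field_cong:
  assumes "\<And>x v. v \<in> \<Omega>v \<Longrightarrow> f x v = g x v"
  shows "E_field a b \<Omega>v f x = E_field a b \<Omega>v g x"
proof -
  have "rho \<Omega>v f y = rho \<Omega>v g y" for y
    by (rule rho_cong) (rule assms)
  then show ?thesis
    unfolding E_field_def poisson_potential_def by simp
qed

text \<open>
  Openness of \<open>\<Omega>v\<close> makes the velocity gradient at a point of \<open>\<Omega>v\<close> depend only on values in
  \<open>\<Omega>v\<close>.
\<close>

lemma RHS_cong:
  assumes "open \<Omega>v" "\<And>x v. v \<in> \<Omega>v \<Longrightarrow> f x v = g x v" "v \<in> \<Omega>v"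
  shows "RHS a b \<Omega>v f x v = RHS a b \<Omega>v g x v"
proof -
  have "partial t (f x) v = partial t (g x) v" for t
    by (rule partial_cong_open[OF assms(1,3,2)])
  then have "grad (f x) v = grad (g x) v"
    by (simp add: grad_def)
  moreover have "(\<lambda>y. f y v) = (\<lambda>y. g y v)"
    using assms(2,3) by auto
  ultimately show ?thesis
    using E_field_cong[of \<Omega>v f g a b x] assms(2) by (simp add: RHS_def)
qed

lemma E_field_obtain_potential:
  assumes "\<exists>\<phi>. poisson_potential a b \<Omega>v f \<phi>"
  obtains \<phi> where "C2_on UNIV \<phi>" "periodic a b \<phi>" "\<And>x. rho \<Omega>v f x = 1 + laplacian \<phi> x"
    and "\<And>x i. E_field a b \<Omega>v f x $ i = - partial i \<phi> x"
proof -
  define \<phi> where "\<phi> = (SOME \<phi>. poisson_potential a b \<Omega>v f \<phi>)"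
  have "poisson_potential a b \<Omega>v f \<phi>"
    unfolding \<phi>_def by (rule someI_ex[OF assms])
  then have "C2_on UNIV \<phi>" "periodic a b \<phi>" and lap: "- laplacian \<phi> x = 1 - rho \<Omega>v f x" for x
    by (auto simp: poisson_potential_def)
  moreover have "rho \<Omega>v f x = 1 + laplacian \<phi> x" for x
    using lap[of x] by simp
  moreover have "E_field a b \<Omega>v f x $ i = - partial i \<phi> x" for x i
    by (simp add: E_field_def \<phi>_def[symmetric] grad_def)
  ultimately show ?thesis
    using that by blast
qed

lemma continuous_on_E_field:
  assumes "\<exists>\<phi>. poisson_potential a b \<Omega>v f \<phi>"
  shows "continuous_on D (\<lambda>x. E_field a b \<Omega>v f x $ i)"
proof -
  obtain \<phi> where \<phi>: "C2_on UNIV \<phi>" "\<And>x i. E_field a b \<Omega>v f x $ i = - partial i \<phi> x"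
    by (rule E_field_obtain_potential[OF assms]) blast
  then show ?thesis
    using C1_on_UNIV_continuous_partial by (auto simp: C2_on_def intro!: continuous_intros)
qed

text \<open>
  The field exerts no net force on the particles.  By the Poisson equation the density is
  \<open>1 + laplacian \<phi>\<close>, so the product of density and field is \<open>- \<partial>\<^sub>i \<phi> - \<partial>\<^sub>i \<phi> laplacian \<phi>\<close>.
\<close>

lemma total_force_zero:
  assumes ab: "\<And>i. a $ i < b $ i" and pot: "\<exists>\<phi>. poisson_potential a b \<Omega>v f \<phi>"
  shows "set_integrable lborel (cbox a b) (\<lambda>x. rho \<Omega>v f x * E_field a b \<Omega>v f x $ i)"
    and "(LINT x:cbox a b|lborel. rho \<Omega>v f x * E_field a b \<Omega>v f x $ i) = 0"
proof -
  obtain \<phi> where \<phi>: "C2_on UNIV \<phi>" "periodic a b \<phi>" and rho: "\<And>x. rho \<Omega>v f x = 1 + laplacian \<phi> x"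
    and E: "\<And>x i. E_field a b \<Omega>v f x $ i = - partial i \<phi> x"
    by (rule E_field_obtain_potential[OF pot]) blast
  have C1: "C1_on UNIV \<phi>" "\<And>j. C1_on UNIV (partial j \<phi>)"
    using \<phi>(1) by (auto simp: C2_on_def)
  have "continuous_on (cbox a b) (\<lambda>x. laplacian \<phi> x)"
    unfolding laplacian_def by (intro continuous_on_sum C1_on_UNIV_continuous_partial C1)
  then have int: "set_integrable lborel (cbox a b) (\<lambda>x. - partial i \<phi> x)"
      "set_integrable lborel (cbox a b) (\<lambda>x. partial i \<phi> x * laplacian \<phi> x)"
    using C1_on_UNIV_continuous[OF C1(2)]
    by (auto intro!: set_integrable_continuous_cbox continuous_on_minus continuous_on_mult)
  have eq: "rho \<Omega>v f x * E_field a b \<Omega>v f x $ i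
      = - partial i \<phi> x - partial i \<phi> x * laplacian \<phi> x" for x
    by (simp add: rho E algebra_simps)
  show "set_integrable lborel (cbox a b) (\<lambda>x. rho \<Omega>v f x * E_field a b \<Omega>v f x $ i)"
    unfolding eq using int by (rule set_integral_diff(1))
  have "(LINT x:cbox a b|lborel. - partial i \<phi> x) = 0"
    using integral_partial_periodic[OF ab C1(1) \<phi>(2), of i]
    by (simp add: set_lebesgue_integral_def)
  then show "(LINT x:cbox a b|lborel. rho \<Omega>v f x * E_field a b \<Omega>v f x $ i) = 0"
    unfolding eq
    using set_integral_diff(2)[OF int] integral_partial_laplacian_periodic[OF ab \<phi>, of i] by simp
qed

section \<open>Moments of low-rank functions\<close>

lemma sum_pairs_swap:
  fixes F :: "'a \<Rightarrow> 'b \<Rightarrow> 'c \<Rightarrow> 'd \<Rightarrow> 'e::comm_monoid_add"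
  shows "(\<Sum>k\<in>A. \<Sum>l\<in>B. \<Sum>i\<in>C. \<Sum>j\<in>D. F k l i j) = (\<Sum>i\<in>C. \<Sum>j\<in>D. \<Sum>k\<in>A. \<Sum>l\<in>B. F k l i j)"
proof -
  have "(\<Sum>k\<in>A. \<Sum>l\<in>B. \<Sum>i\<in>C. \<Sum>j\<in>D. F k l i j) = (\<Sum>k\<in>A. \<Sum>i\<in>C. \<Sum>j\<in>D. \<Sum>l\<in>B. F k l i j)"
    by (intro sum.cong refl, subst sum.swap, intro sum.cong refl sum.swap)
  also have "\<dots> = (\<Sum>i\<in>C. \<Sum>j\<in>D. \<Sum>k\<in>A. \<Sum>l\<in>B. F k l i j)"
    by (subst sum.swap, intro sum.cong refl sum.swap)
  finally show ?thesis .
qed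

lemma lowrank_moment:
  assumes "\<And>j. j \<in> {1..q} \<Longrightarrow> set_integrable lborel A (\<lambda>v. w v * (V j v * h v))"
  shows "set_integrable lborel A (\<lambda>v. lowrank w p q X S V x v * h v)"
    and "(LINT v:A|lborel. lowrank w p q X S V x v * h v)
      = (\<Sum>i=1..p. \<Sum>j=1..q. X i x * S i j * ip_v A w (V j) h)"
proof -
  have eq: "lowrank w p q X S V x v * h v
      = (\<Sum>i=1..p. \<Sum>j=1..q. X i x * S i j * (w v * (V j v * h v)))" for v
    by (simp add: lowrank_def sum_distrib_left sum_distrib_right mult_ac)
  have int: "set_integrable lborel A (\<lambda>v. X i x * S i j * (w v * (V j v * h v)))" if "j \<in> {1..q}" for i j
    using assms[OF that] by (rule set_integrable_mult_right)
  have int2: "set_integrable lborel A (\<lambda>v. \<Sum>j=1..q. X i x * S i j * (w v * (V j v * h v)))" for i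
    by (rule set_integral_finite_sum(1)[OF int])
  show "set_integrable lborel A (\<lambda>v. lowrank w p q X S V x v * h v)"
    unfolding eq by (rule set_integral_finite_sum(1)[OF int2])
  show "(LINT v:A|lborel. lowrank w p q X S V x v * h v)
      = (\<Sum>i=1..p. \<Sum>j=1..q. X i x * S i j * ip_v A w (V j) h)"
    unfolding eq set_integral_finite_sum(2)[OF int2]
    by (intro sum.cong refl, subst set_integral_finite_sum(2)[OF int]) (auto simp: ip_v_def)
qed

lemma lowrank_moment_integrable_prod:
  assumes "\<And>j. j \<in> {1..q} \<Longrightarrow> set_integrable lborel A (\<lambda>v. w v * (V j v * h v))"
    and "\<And>i. i \<in> {1..p} \<Longrightarrow> set_integrable lborel B (X i)"
  shows "set_integrable lborel (B \<times> A) (\<lambda>z. lowrank w p q X S V (fst z) (snd z) * h (snd z))"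
proof -
  have eq: "lowrank w p q X S V (fst z) (snd z) * h (snd z)
      = (\<Sum>i=1..p. \<Sum>j=1..q. S i j * (X i (fst z) * (w (snd z) * (V j (snd z) * h (snd z)))))" for z
    by (simp add: lowrank_def sum_distrib_left sum_distrib_right mult_ac)
  show ?thesis
    unfolding eq
    by (intro set_integral_finite_sum(1) set_integrable_mult_right set_integrable_prod assms)
qed

lemma momentum_nth:
  assumes "\<And>c. set_integrable lborel \<Omega>v (\<lambda>v. f x v * v $ c)"
  shows "momentum \<Omega>v f x $ c = (LINT v:\<Omega>v|lborel. f x v * v $ c)"
  unfolding momentum_def using set_integral_vec_nth(2)[of lborel \<Omega>v "\<lambda>v. f x v *\<^sub>R v" c] assms
  by simp

section \<open>Velocity moments of the right-hand side\<close>

text \<open>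
  A numerical solution at the beginning of a time step: a low-rank function \<open>f\<close> with admissible
  factors whose first \<open>m\<close> velocity functions are the fixed functions \<open>U\<close>, together with the
  solvability of its Poisson equation, without which the field \<open>E\<close> would be arbitrary.
\<close>

locale lowrank_state =
  fixes a b :: "real^'d" and \<Omega>v :: "(real^'d) set" and f0v :: "real^'d \<Rightarrow> real"
    and e :: "nat \<Rightarrow> 'd" and m r :: nat
    and X V :: "nat \<Rightarrow> real^'d \<Rightarrow> real" and S :: "nat \<Rightarrow> nat \<Rightarrow> real"
  assumes open_\<Omega>v: "open \<Omega>v"
    and weight: "admissible_weight \<Omega>v f0v e m"
    and m_le_r: "m \<le> r"
    and factors: "lowrank_factors a b \<Omega>v f0v e m r X V"
    and potential: "\<exists>\<phi>. poisson_potential a b \<Omega>v (lowrank f0v r r X S V) \<phi>"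
begin

abbreviation "f \<equiv> lowrank f0v r r X S V"
abbreviation "U \<equiv> fixed_fun \<Omega>v f0v e"
abbreviation "E \<equiv> E_field a b \<Omega>v f"

lemma weight_measurable: "set_borel_measurable lborel \<Omega>v f0v"
proof -
  have "continuous_on \<Omega>v f0v"
    using weight by (auto simp: admissible_weight_def C1_on_def differentiable_imp_continuous_on)
  then show ?thesis
    using set_measurable_continuous_on[of \<Omega>v f0v] open_\<Omega>v
    by (simp add: set_borel_measurable_def)
qed

lemma weight_pos: "v \<in> \<Omega>v \<Longrightarrow> 0 < f0v v"
  using weight by (simp add: admissible_weight_def)

lemma weight_nonneg: "v \<in> \<Omega>v \<Longrightarrow> 0 \<le> f0v v"
  using weight_pos by (simp add: less_imp_le)

lemmas mult_integrable = L2_v_mult_integrable[OF weight_measurable weight_nonneg]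

lemma U_orthonormal: "orthonormal_v \<Omega>v f0v m U"
  using weight by (simp add: admissible_weight_def)

lemma U_L2: "k \<in> {1..m} \<Longrightarrow> L2_v \<Omega>v f0v (U k)"
  using U_orthonormal by (simp add: orthonormal_v_def)

lemma one_L2: "L2_v \<Omega>v f0v (\<lambda>_. 1)"
  using weight by (simp add: admissible_weight_def)

lemma velocity_L2: "L2_v \<Omega>v f0v (\<lambda>v. v $ c)"
  using weight by (simp add: admissible_weight_def)

lemma X_L2: "i \<in> {1..r} \<Longrightarrow> L2_x a b (X i)"
  and X_C1: "i \<in> {1..r} \<Longrightarrow> C1_on UNIV (X i)"
  and V_orthonormal: "orthonormal_v \<Omega>v f0v r V"
  and V_C1: "j \<in> {1..r} \<Longrightarrow> C1_on \<Omega>v (V j)"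
  and V_fixed: "k \<in> {1..m} \<Longrightarrow> v \<in> \<Omega>v \<Longrightarrow> V k v = U k v"
  and velocity_V_L2: "j \<in> {1..r} \<Longrightarrow> L2_v \<Omega>v f0v (\<lambda>v. v $ t * V j v)"
  and partial_V_L2: "j \<in> {1..r} \<Longrightarrow> L2_v \<Omega>v f0v (\<lambda>v. partial t (\<lambda>w. f0v w * V j w) v / f0v v)"
  and integration_by_parts: "k \<in> {1..m} \<Longrightarrow> j \<in> {1..r} \<Longrightarrow>
    (LINT v:\<Omega>v|lborel. U k v * partial t (\<lambda>w. f0v w * V j w) v)
    = - (LINT v:\<Omega>v|lborel. partial t (U k) v * (f0v v * V j v))"
  using factors by (simp_all add: lowrank_factors_def orthonormal_x_def)

lemma V_L2: "j \<in> {1..r} \<Longrightarrow> L2_v \<Omega>v f0v (V j)"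
  using V_orthonormal by (simp add: orthonormal_v_def)

lemma weighted_V_differentiable:
  assumes "j \<in> {1..r}" "v \<in> \<Omega>v"
  shows "(\<lambda>w. f0v w * V j w) differentiable at v"
proof -
  have "f0v differentiable_on \<Omega>v" "V j differentiable_on \<Omega>v"
    using weight V_C1[OF assms(1)] by (auto simp: admissible_weight_def C1_on_def)
  then show ?thesis
    using assms(2) open_\<Omega>v
    by (auto simp: differentiable_on_eq_differentiable_at intro: differentiable_mult)
qed

text \<open>
  The decay hypothesis concerns the derivative divided by the weight, which is cancelled by the
  weight in the inner product.
\<close>

lemma mult_partial_V_integrable:
  assumes u: "L2_v \<Omega>v f0v u" and j: "j \<in> {1..r}"
  shows "set_integrable lborel \<Omega>v (\<lambda>v. u v * partial t (\<lambda>w. f0v w * V j w) v)"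
proof -
  have "f0v v * (u v * (partial t (\<lambda>w. f0v w * V j w) v / f0v v))
      = u v * partial t (\<lambda>w. f0v w * V j w) v" if "v \<in> \<Omega>v" for v
    using weight_pos[OF that] by simp
  from set_integrable_eqI[where f = "\<lambda>v. f0v v * (u v * (partial t (\<lambda>w. f0v w * V j w) v / f0v v))",
      OF this] mult_integrable[OF _ u partial_V_L2[OF j]]
  show ?thesis
    by blast
qed

text \<open>
  The right-hand side is again a finite sum of products of a function of \<open>x\<close> and a function of \<open>v\<close>;
  its moments and its pairings over the phase space are computed term by term.
\<close>

lemma RHS_lowrank:
  assumes v: "v \<in> \<Omega>v"
  shows "RHS a b \<Omega>v f x v = (\<Sum>i=1..r. \<Sum>j=1..r. S i j * (\<Sum>t\<in>UNIV.
      E x $ t * X i x * partial t (\<lambda>w. f0v w * V j w) v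
      - partial t (X i) x * (f0v v * (v $ t * V j v))))"
proof -
  have px: "partial t (\<lambda>y. f y v) x = (\<Sum>i=1..r. \<Sum>j=1..r. f0v v * V j v * S i j * partial t (X i) x)" for t
  proof -
    have "(\<lambda>y. f y v) = (\<lambda>y. \<Sum>i=1..r. (\<Sum>j=1..r. f0v v * V j v * S i j) * X i y)"
      by (simp add: fun_eq_iff lowrank_def sum_distrib_left sum_distrib_right mult_ac)
    then have "partial t (\<lambda>y. f y v) x
        = (\<Sum>i=1..r. (\<Sum>j=1..r. f0v v * V j v * S i j) * partial t (X i) x)"
      by (simp only:) (rule partial_weighted_sum[OF C1_on_UNIV_differentiable[OF X_C1]])
    then show ?thesis
      by (simp add: sum_distrib_right)
  qed
  have pv: "partial t (f x) v = (\<Sum>i=1..r. \<Sum>j=1..r. X i x * S i j * partial t (\<lambda>w. f0v w * V j w) v)" for t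
  proof -
    have "f x = (\<lambda>w. \<Sum>j=1..r. (\<Sum>i=1..r. X i x * S i j) * (f0v w * V j w))"
      unfolding lowrank_def fun_eq_iff sum_distrib_left sum_distrib_right
      by (subst sum.swap) (simp add: mult_ac)
    then have "partial t (f x) v
        = (\<Sum>j=1..r. (\<Sum>i=1..r. X i x * S i j) * partial t (\<lambda>w. f0v w * V j w) v)"
      by (simp only:) (rule partial_weighted_sum[OF weighted_V_differentiable[OF _ v]])
    then show ?thesis
      by (simp add: sum_distrib_right) (rule sum.swap)
  qed
  have "RHS a b \<Omega>v f x v = (\<Sum>t\<in>UNIV. \<Sum>i=1..r. \<Sum>j=1..r.
      S i j * (E x $ t * X i x * partial t (\<lambda>w. f0v w * V j w) v
        - partial t (X i) x * (f0v v * (v $ t * V j v))))"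
    unfolding RHS_def inner_vec_def grad_def
    by (simp add: px pv sum_distrib_left sum_subtractf algebra_simps)
  also have "\<dots> = (\<Sum>i=1..r. \<Sum>j=1..r. \<Sum>t\<in>UNIV.
      S i j * (E x $ t * X i x * partial t (\<lambda>w. f0v w * V j w) v
        - partial t (X i) x * (f0v v * (v $ t * V j v))))"
    by (subst sum.swap) (intro sum.cong refl sum.swap)
  finally show ?thesis
    by (simp only: sum_distrib_left)
qed

lemma RHS_moment:
  assumes u: "L2_v \<Omega>v f0v u"
  shows "pair_v \<Omega>v u (RHS a b \<Omega>v f x) = (\<Sum>i=1..r. \<Sum>j=1..r. S i j * (\<Sum>t\<in>UNIV.
      E x $ t * X i x * (LINT v:\<Omega>v|lborel. u v * partial t (\<lambda>w. f0v w * V j w) v)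
      - partial t (X i) x * ip_v \<Omega>v f0v u (\<lambda>v. v $ t * V j v)))"
proof -
  let ?p = "\<lambda>t j v. u v * partial t (\<lambda>w. f0v w * V j w) v"
  let ?q = "\<lambda>t j v. f0v v * (u v * (v $ t * V j v))"
  have int: "set_integrable lborel \<Omega>v (\<lambda>v. E x $ t * X i x * ?p t j v)"
    "set_integrable lborel \<Omega>v (\<lambda>v. partial t (X i) x * ?q t j v)" if "j \<in> {1..r}" for i j t
    using mult_partial_V_integrable[OF u that] mult_integrable[OF _ u velocity_V_L2[OF that]]
    by (auto intro!: set_integrable_mult_right simp: mult.assoc)
  have int3: "set_integrable lborel \<Omega>v (\<lambda>v. E x $ t * X i x * ?p t j v - partial t (X i) x * ?q t j v)"
    if "j \<in> {1..r}" for i j t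
    by (rule set_integral_diff(1)[OF int[OF that]])
  have int2: "set_integrable lborel \<Omega>v
      (\<lambda>v. S i j * (\<Sum>t\<in>UNIV. E x $ t * X i x * ?p t j v - partial t (X i) x * ?q t j v))"
    if "j \<in> {1..r}" for i j
    by (intro set_integrable_mult_right set_integral_finite_sum(1) int3 that)
  have int1: "set_integrable lborel \<Omega>v
      (\<lambda>v. \<Sum>j=1..r. S i j * (\<Sum>t\<in>UNIV. E x $ t * X i x * ?p t j v - partial t (X i) x * ?q t j v))" for i
    by (intro set_integral_finite_sum(1) int2)
  have "pair_v \<Omega>v u (RHS a b \<Omega>v f x) = (LINT v:\<Omega>v|lborel. \<Sum>i=1..r. \<Sum>j=1..r.
      S i j * (\<Sum>t\<in>UNIV. E x $ t * X i x * ?p t j v - partial t (X i) x * ?q t j v))"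
    unfolding pair_v_def
    by (rule set_integral_eqI)
      (simp add: RHS_lowrank sum_distrib_left sum_subtractf algebra_simps)
  also have "\<dots> = (\<Sum>i=1..r. LINT v:\<Omega>v|lborel. \<Sum>j=1..r.
      S i j * (\<Sum>t\<in>UNIV. E x $ t * X i x * ?p t j v - partial t (X i) x * ?q t j v))"
    by (rule set_integral_finite_sum(2)[OF int1])
  also have "\<dots> = (\<Sum>i=1..r. \<Sum>j=1..r. LINT v:\<Omega>v|lborel.
      S i j * (\<Sum>t\<in>UNIV. E x $ t * X i x * ?p t j v - partial t (X i) x * ?q t j v))"
    by (intro sum.cong refl set_integral_finite_sum(2)[OF int2])
  also have "\<dots> = (\<Sum>i=1..r. \<Sum>j=1..r. S i j * (\<Sum>t\<in>UNIV. LINT v:\<Omega>v|lborel.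
      E x $ t * X i x * ?p t j v - partial t (X i) x * ?q t j v))"
    by (intro sum.cong refl) (simp only: set_integral_mult_right set_integral_finite_sum(2)[OF int3])
  also have "\<dots> = (\<Sum>i=1..r. \<Sum>j=1..r. S i j * (\<Sum>t\<in>UNIV.
      E x $ t * X i x * (LINT v:\<Omega>v|lborel. ?p t j v) - partial t (X i) x * ip_v \<Omega>v f0v u (\<lambda>v. v $ t * V j v)))"
    by (intro sum.cong refl)
      (simp only: set_integral_diff(2)[OF int] set_integral_mult_right ip_v_def)
  finally show ?thesis .
qed

lemma continuous_on_RHS_moment:
  assumes "L2_v \<Omega>v f0v u"
  shows "continuous_on D (\<lambda>x. pair_v \<Omega>v u (RHS a b \<Omega>v f x))"
  unfolding RHS_moment[OF assms]
  by (intro continuous_on_sum continuous_on_mult continuous_on_diff continuous_on_const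
      continuous_on_E_field[OF potential] C1_on_UNIV_continuous_partial[OF X_C1]
      C1_on_UNIV_continuous[OF X_C1])

lemma pair_xv_RHS:
  assumes Y: "L2_x a b Y" and u: "L2_v \<Omega>v f0v u"
  shows "pair_xv a b \<Omega>v (\<lambda>x v. Y x * u v) (RHS a b \<Omega>v f)
    = ip_x a b Y (\<lambda>x. pair_v \<Omega>v u (RHS a b \<Omega>v f x))"
proof -
  let ?p = "\<lambda>t j v. u v * partial t (\<lambda>w. f0v w * V j w) v"
  let ?q = "\<lambda>t j v. f0v v * (u v * (v $ t * V j v))"
  have Yint: "set_integrable lborel (cbox a b) (\<lambda>x. Y x * (E x $ t * X i x))"
    "set_integrable lborel (cbox a b) (\<lambda>x. Y x * partial t (X i) x)" if "i \<in> {1..r}" for i t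
    by (intro L2_x_mult_continuous_integrable[OF Y] continuous_on_mult
        continuous_on_E_field[OF potential] C1_on_UNIV_continuous_partial[OF X_C1]
        C1_on_UNIV_continuous[OF X_C1] that)+
  have "set_integrable lborel (cbox a b \<times> \<Omega>v) (\<lambda>z. \<Sum>i=1..r. \<Sum>j=1..r. S i j * (\<Sum>t\<in>UNIV.
      (Y (fst z) * (E (fst z) $ t * X i (fst z))) * ?p t j (snd z)
      - (Y (fst z) * partial t (X i) (fst z)) * ?q t j (snd z)))"
    by (intro set_integral_finite_sum(1) set_integrable_mult_right set_integral_diff(1)
        set_integrable_prod Yint mult_partial_V_integrable u mult_integrable velocity_V_L2)
  also have "?this \<longleftrightarrow> set_integrable lborel (cbox a b \<times> \<Omega>v)
      (\<lambda>z. (Y (fst z) * u (snd z)) * RHS a b \<Omega>v f (fst z) (snd z))"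
    by (rule set_integrable_eqI)
      (auto simp: RHS_lowrank sum_distrib_left sum_subtractf algebra_simps)
  finally have "pair_xv a b \<Omega>v (\<lambda>x v. Y x * u v) (RHS a b \<Omega>v f)
      = (LINT x:cbox a b|lborel. LINT v:\<Omega>v|lborel. (Y x * u v) * RHS a b \<Omega>v f x v)"
    unfolding pair_xv_def by (rule set_integral_Fubini)
  then show ?thesis
    by (simp add: ip_x_def pair_v_def mult.assoc)
qed

section \<open>Velocity components as fixed functions\<close>

text \<open>
  The normalising constant cannot vanish: division by zero would make \<open>U k\<close> the zero function,
  contrary to its norm being 1.
\<close>

lemma velocity_fixed:
  assumes e: "bij_betw e {1..CARD('d)} UNIV" and m: "CARD('d) + 1 \<le> m"
  obtains k n where "k \<in> {1..m}" "n \<noteq> 0" "\<And>v. U k v = v $ c / n" "\<And>v. v $ c = n * U k v"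
proof -
  obtain s where s: "s \<in> {1..CARD('d)}" "e s = c"
    using e by (metis UNIV_I bij_betw_def imageE)
  define n where "n = norm_v \<Omega>v f0v (\<lambda>v. v $ c)"
  have k: "s + 1 \<in> {1..m}"
    using s m by auto
  have U: "U (s + 1) v = v $ c / n" for v
    using s by (auto simp: fixed_fun_def n_def)
  have "n \<noteq> 0"
  proof
    assume "n = 0"
    then have "U (s + 1) = (\<lambda>_. 0)"
      using U by auto
    then have "ip_v \<Omega>v f0v (U (s + 1)) (U (s + 1)) = 0"
      by (simp add: ip_v_def)
    moreover have "ip_v \<Omega>v f0v (U (s + 1)) (U (s + 1)) = 1"
      using U_orthonormal k unfolding orthonormal_v_def by auto
    ultimately show False
      by simp
  qed
  with k U show ?thesis
    by (intro that[of "s + 1" n]) auto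
qed

section \<open>The step in the augmented bases\<close>

text \<open>
  The Galerkin step in the augmented bases is exact for the fixed velocity functions.  Column \<open>k\<close>
  of the new coefficient matrix consists of the coefficients of \<open>K_new k\<close> with respect to the
  spatial basis, and this basis was chosen so that \<open>K_new k\<close> lies in its span.
\<close>

lemma augmented_column:
  assumes aug: "augmented_bases a b \<Omega>v f0v e \<tau> m r X S V nx Xt nv Vt" and k: "k \<in> {1..m}"
  shows "(\<Sum>l=1..nx. Xt l x * S_new a b \<Omega>v f0v \<tau> r X S V nx Xt nv Vt l k)
    = K_new a b \<Omega>v f0v \<tau> r X S V k x"
proof -
  let ?K = "K_new a b \<Omega>v f0v \<tau> r X S V"
  define S0 where "S0 = S_proj a b \<Omega>v f0v r X S V Xt Vt"
  define G where "G = (\<lambda>x. pair_v \<Omega>v (V k) (RHS a b \<Omega>v f x))"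
  have Xt: "orthonormal_x a b nx Xt"
    and spX: "span_on UNIV (Xt ` {1..nx}) = span_on UNIV (X ` {1..r} \<union>
        {partial s (X i) | s i. i \<in> {1..r}} \<union> ?K ` {1..r})"
    and Vt: "orthonormal_v \<Omega>v f0v nv Vt"
    and spV: "span_on \<Omega>v (Vt ` {1..nv}) = span_on \<Omega>v (U ` {1..m}
        \<union> L_new a b \<Omega>v f0v \<tau> m r X S V ` {m+1..r} \<union> V ` {m+1..r})"
    and Vt_fixed: "\<And>k v. k \<in> {1..m} \<Longrightarrow> v \<in> \<Omega>v \<Longrightarrow> Vt k v = U k v"
    using aug by (auto simp: augmented_bases_def)
  have k_r: "k \<in> {1..r}"
    using k m_le_r by auto
  have Vk: "Vt k v = V k v" if "v \<in> \<Omega>v" for v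
    using Vt_fixed[OF k that] V_fixed[OF k that] by simp
  have expand_x: "h x = (\<Sum>l=1..nx. ip_x a b (Xt l) h * Xt l x)"
    if "h \<in> span_on UNIV (Xt ` {1..nx})" for h x
    unfolding ip_x_eq_ip_v
    by (rule orthonormal_expansion[OF set_borel_measurable_const_cbox _
          orthonormal_x_imp_orthonormal_v[OF Xt] subset_UNIV that]) auto
  have X_exp: "X i x = (\<Sum>l=1..nx. ip_x a b (Xt l) (X i) * Xt l x)" if "i \<in> {1..r}" for i x
    by (rule expand_x, unfold spX, rule span_on_superset) (use that in blast)
  have K_exp: "?K k x = (\<Sum>l=1..nx. ip_x a b (Xt l) (?K k) * Xt l x)" for x
    by (rule expand_x, unfold spX, rule span_on_superset) (use k_r in blast)
  have V_exp: "V j v = (\<Sum>l=1..nv. ip_v \<Omega>v f0v (V j) (Vt l) * Vt l v)"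
    if j: "j \<in> {1..r}" and v: "v \<in> \<Omega>v" for j v
  proof -
    have "V j \<in> span_on \<Omega>v (Vt ` {1..nv})"
    proof (cases "j \<le> m")
      case True
      then have "U j \<in> U ` {1..m}"
        using j by auto
      then have "U j \<in> span_on \<Omega>v (Vt ` {1..nv})"
        unfolding spV by (intro span_on_superset) blast
      then show ?thesis
        using V_fixed[of j] True j by (simp add: span_on_def)
    next
      case False
      then have "V j \<in> V ` {m+1..r}"
        using j by auto
      then show ?thesis
        unfolding spV by (intro span_on_superset) blast
    qed
    from orthonormal_expansion[OF weight_measurable weight_nonneg Vt subset_refl this v]
    show ?thesis
      by (subst ip_v_commute)
  qed
  \<comment> \<open>The augmented bases represent \<open>f\<close> without projection error on \<open>\<Omega>v\<close>, so the step
     evaluates the right-hand side at \<open>f\<close> itself.\<close>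
  have g: "lowrank f0v nx nv Xt S0 Vt x v = f x v" if v: "v \<in> \<Omega>v" for x v
  proof -
    have "(\<Sum>k=1..nx. \<Sum>l=1..nv. Xt k x * S0 k l * Vt l v)
        = (\<Sum>k=1..nx. \<Sum>l=1..nv. \<Sum>i=1..r. \<Sum>j=1..r.
            (ip_x a b (Xt k) (X i) * Xt k x) * S i j * (ip_v \<Omega>v f0v (V j) (Vt l) * Vt l v))"
      by (simp add: S0_def S_proj_def sum_distrib_left sum_distrib_right mult_ac)
    also have "\<dots> = (\<Sum>i=1..r. \<Sum>j=1..r. \<Sum>k=1..nx. \<Sum>l=1..nv.
            (ip_x a b (Xt k) (X i) * Xt k x) * S i j * (ip_v \<Omega>v f0v (V j) (Vt l) * Vt l v))"
      by (rule sum_pairs_swap)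
    also have "\<dots> = (\<Sum>i=1..r. \<Sum>j=1..r.
          (\<Sum>k=1..nx. ip_x a b (Xt k) (X i) * Xt k x) * S i j
            * (\<Sum>l=1..nv. ip_v \<Omega>v f0v (V j) (Vt l) * Vt l v))"
      by (simp add: sum_distrib_left sum_distrib_right mult_ac)
    also have "\<dots> = (\<Sum>i=1..r. \<Sum>j=1..r. X i x * S i j * V j v)"
      by (intro sum.cong refl) (simp only: X_exp[symmetric] V_exp[OF _ v, symmetric])
    finally show ?thesis
      by (simp add: lowrank_def)
  qed
  have Gint: "set_integrable lborel (cbox a b) (\<lambda>x. Xt l x * G x)" if "l \<in> {1..nx}" for l
    unfolding G_def using Xt that
    by (intro L2_x_mult_continuous_integrable continuous_on_RHS_moment V_L2 k_r)
      (auto simp: orthonormal_x_def)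
  have "S_new a b \<Omega>v f0v \<tau> r X S V nx Xt nv Vt l k = ip_x a b (Xt l) (?K k)"
    if l: "l \<in> {1..nx}" for l
  proof -
    have Xtl: "L2_x a b (Xt l)"
      using Xt l by (auto simp: orthonormal_x_def)
    have Xint: "set_integrable lborel (cbox a b) (\<lambda>x. Xt l x * X i x)" if "i \<in> {1..r}" for i
      by (rule L2_x_mult_integrable[OF Xtl X_L2[OF that]])
    have "pair_xv a b \<Omega>v (\<lambda>x v. Xt l x * Vt k v) (RHS a b \<Omega>v (lowrank f0v nx nv Xt S0 Vt))
        = pair_xv a b \<Omega>v (\<lambda>x v. Xt l x * V k v) (RHS a b \<Omega>v f)"
      unfolding pair_xv_def
    proof (rule set_integral_eqI)
      fix z assume "z \<in> cbox a b \<times> \<Omega>v"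
      then have z: "snd z \<in> \<Omega>v"
        by auto
      show "Xt l (fst z) * Vt k (snd z) * RHS a b \<Omega>v (lowrank f0v nx nv Xt S0 Vt) (fst z) (snd z)
          = Xt l (fst z) * V k (snd z) * RHS a b \<Omega>v f (fst z) (snd z)"
        using RHS_cong[where f = "lowrank f0v nx nv Xt S0 Vt" and g = f, OF open_\<Omega>v g z] Vk[OF z]
        by simp
    qed
    also have "\<dots> = ip_x a b (Xt l) G"
      unfolding G_def by (rule pair_xv_RHS[OF Xtl V_L2[OF k_r]])
    finally have P: "pair_xv a b \<Omega>v (\<lambda>x v. Xt l x * Vt k v)
        (RHS a b \<Omega>v (lowrank f0v nx nv Xt S0 Vt)) = ip_x a b (Xt l) G" .
    have "ip_v \<Omega>v f0v (V j) (Vt k) = (if j = k then 1 else 0)" if "j \<in> {1..r}" for j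
    proof -
      have "ip_v \<Omega>v f0v (V j) (Vt k) = ip_v \<Omega>v f0v (V j) (V k)"
        by (rule ip_v_cong) (simp_all add: Vk)
      then show ?thesis
        using V_orthonormal that k_r by (simp add: orthonormal_v_def)
    qed
    then have "S0 l k = (\<Sum>i=1..r. \<Sum>j=1..r. if j = k then ip_x a b (Xt l) (X i) * S i j else 0)"
      unfolding S0_def S_proj_def by (intro sum.cong refl) simp
    also have "\<dots> = (\<Sum>i=1..r. ip_x a b (Xt l) (X i) * S i k)"
      using k_r by (simp add: sum.delta)
    finally have S0: "S0 l k = (\<Sum>i=1..r. S i k * ip_x a b (Xt l) (X i))"
      by (simp add: mult.commute)
    have "ip_x a b (Xt l) (?K k) = (LINT x:cbox a b|lborel.
        (\<Sum>i=1..r. S i k * (Xt l x * X i x)) + \<tau> * (Xt l x * G x))"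
      unfolding ip_x_def K_new_def G_def
      by (rule set_integral_eqI) (simp add: sum_distrib_left algebra_simps)
    also have "\<dots> = (LINT x:cbox a b|lborel. \<Sum>i=1..r. S i k * (Xt l x * X i x))
        + (LINT x:cbox a b|lborel. \<tau> * (Xt l x * G x))"
      by (intro set_integral_add(2) set_integral_finite_sum(1) set_integrable_mult_right Xint Gint l)
    also have "(LINT x:cbox a b|lborel. \<Sum>i=1..r. S i k * (Xt l x * X i x))
        = (\<Sum>i=1..r. LINT x:cbox a b|lborel. S i k * (Xt l x * X i x))"
      by (intro set_integral_finite_sum(2) set_integrable_mult_right Xint)
    finally have "ip_x a b (Xt l) (?K k) = S0 l k + \<tau> * ip_x a b (Xt l) G"
      by (simp add: S0 ip_x_def)
    then show ?thesis
      by (simp add: S_new_def S0_def[symmetric] P)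
  qed
  then show ?thesis
    by (subst K_exp) (intro sum.cong, auto simp: mult.commute)
qed

section \<open>Truncation\<close>

text \<open>
  The truncation leaves the first \<open>m\<close> velocity moments untouched: the columns belonging to the fixed
  functions are only rewritten by QR decompositions, and the functions produced by the singular
  value decomposition are combinations of basis functions orthogonal to all fixed ones.
\<close>

lemma truncation_moment:
  assumes Vt: "orthonormal_v \<Omega>v f0v nv Vt" and mnv: "m \<le> nv"
    and Vt_fixed: "\<And>k v. k \<in> {1..m} \<Longrightarrow> v \<in> \<Omega>v \<Longrightarrow> Vt k v = U k v"
    and trunc: "truncation a b \<Omega>v f0v e m r nx Xt St nv Vt X' S' V'"
    and k: "k \<in> {1..m}"
  shows "j \<in> {1..r} \<Longrightarrow> set_integrable lborel \<Omega>v (\<lambda>v. f0v v * (V' j v * U k v))"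
    and "(LINT v:\<Omega>v|lborel. lowrank f0v r r X' S' V' x v * U k v) = (\<Sum>l=1..nx. Xt l x * St l k)"
proof -
  obtain Xcons Scons Wh Xrem R sh where
    QR: "is_QR_x a b m m (\<lambda>l x. \<Sum>k=1..nx. Xt k x * St k l) Xcons Scons"
    and V'_fixed: "\<forall>k\<in>{1..m}. \<forall>v\<in>\<Omega>v. V' k v = U k v"
    and V'_rem: "\<forall>l\<in>{1..r-m}. \<forall>v\<in>\<Omega>v. V' (m + l) v = (\<Sum>j=1..nv-m. Vt (m + j) v * Wh j l)"
    and QR': "is_QR_x a b r r (\<lambda>j. if j \<le> m then Xcons j else Xrem (j - m)) X' R"
    and S': "\<forall>i\<in>{1..r}. \<forall>j\<in>{1..r}. S' i j =
       (\<Sum>l=1..r. R i l * (if l \<le> m \<and> j \<le> m then Scons l j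
                           else if l > m \<and> l = j then sh (l - m) else 0))"
    using trunc unfolding truncation_def Let_def by blast
  have k_r: "k \<in> {1..r}" and k_nv: "k \<in> {1..nv}"
    using k m_le_r mnv by auto
  have V'_U: "set_integrable lborel \<Omega>v (\<lambda>v. f0v v * (V' j v * U k v))
      \<and> ip_v \<Omega>v f0v (V' j) (U k) = (if j = k then 1 else 0)" if j: "j \<in> {1..r}" for j
  proof (cases "j \<le> m")
    case True
    then have jm: "j \<in> {1..m}"
      using j by auto
    have "set_integrable lborel \<Omega>v (\<lambda>v. f0v v * (V' j v * U k v))
        \<longleftrightarrow> set_integrable lborel \<Omega>v (\<lambda>v. f0v v * (U j v * U k v))"
      by (rule set_integrable_eqI) (use V'_fixed jm in simp)
    moreover have "ip_v \<Omega>v f0v (V' j) (U k) = ip_v \<Omega>v f0v (U j) (U k)"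
      by (rule ip_v_cong) (use V'_fixed jm in simp_all)
    moreover have "ip_v \<Omega>v f0v (U j) (U k) = (if j = k then 1 else 0)"
      using U_orthonormal jm k unfolding orthonormal_v_def by blast
    ultimately show ?thesis
      using mult_integrable[OF _ U_L2[OF jm] U_L2[OF k]] by simp
  next
    case False
    define l where "l = j - m"
    have l: "l \<in> {1..r-m}" "j = m + l"
      using False j by (auto simp: l_def)
    let ?s = "\<lambda>v. \<Sum>i=1..nv-m. Wh i l * (f0v v * (Vt (m + i) v * Vt k v))"
    have eq: "f0v v * (V' j v * U k v) = ?s v" if "v \<in> \<Omega>v" for v
      using V'_rem l that Vt_fixed[OF k that]
      by (simp add: sum_distrib_left sum_distrib_right mult_ac)
    have int: "set_integrable lborel \<Omega>v (\<lambda>v. Wh i l * (f0v v * (Vt (m + i) v * Vt k v)))"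
      if "i \<in> {1..nv-m}" for i
      using Vt that k_nv
      by (intro set_integrable_mult_right mult_integrable) (auto simp: orthonormal_v_def)
    have "set_integrable lborel \<Omega>v (\<lambda>v. f0v v * (V' j v * U k v)) \<longleftrightarrow> set_integrable lborel \<Omega>v ?s"
      by (rule set_integrable_eqI) (rule eq)
    moreover have "ip_v \<Omega>v f0v (V' j) (U k) = (LINT v:\<Omega>v|lborel. ?s v)"
      unfolding ip_v_def by (rule set_integral_eqI) (rule eq)
    moreover have "(LINT v:\<Omega>v|lborel. ?s v) = (\<Sum>i=1..nv-m. Wh i l * ip_v \<Omega>v f0v (Vt (m + i)) (Vt k))"
      by (subst set_integral_finite_sum(2)[OF int]) (auto simp: ip_v_def)
    moreover have "\<dots> = 0"
      using Vt k k_nv by (intro sum.neutral) (auto simp: orthonormal_v_def)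
    ultimately show ?thesis
      using set_integral_finite_sum(1)[of "{1..nv-m}", OF int] False k by auto
  qed
  then show "j \<in> {1..r} \<Longrightarrow> set_integrable lborel \<Omega>v (\<lambda>v. f0v v * (V' j v * U k v))"
    by blast
  have "(LINT v:\<Omega>v|lborel. lowrank f0v r r X' S' V' x v * U k v)
      = (\<Sum>i=1..r. \<Sum>j=1..r. X' i x * S' i j * ip_v \<Omega>v f0v (V' j) (U k))"
    by (rule lowrank_moment(2)) (use V'_U in blast)
  also have "\<dots> = (\<Sum>i=1..r. \<Sum>j=1..r. if j = k then X' i x * S' i j else 0)"
    by (intro sum.cong refl) (simp add: V'_U)
  also have "\<dots> = (\<Sum>i=1..r. X' i x * S' i k)"
    using k_r by simp
  also have "\<dots> = (\<Sum>i=1..r. \<Sum>l=1..r. (X' i x * R i l) * (if l \<le> m then Scons l k else 0))"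
    using k k_r S' unfolding sum_distrib_left
    by (intro sum.cong refl) (auto simp: sum_distrib_left intro!: sum.cong)
  also have "\<dots> = (\<Sum>l=1..r. (\<Sum>i=1..r. X' i x * R i l) * (if l \<le> m then Scons l k else 0))"
    by (subst sum.swap) (simp only: sum_distrib_right)
  also have "\<dots> = (\<Sum>l=1..r. if l \<le> m then Xcons l x * Scons l k else 0)"
  proof (intro sum.cong refl)
    fix l assume l: "l \<in> {1..r}"
    \<comment> \<open>The final QR decomposition recovers \<open>Xcons\<close> as the first \<open>m\<close> columns of \<open>X' R\<close>.\<close>
    have "(if l \<le> m then Xcons l else Xrem (l - m)) x = (\<Sum>i=1..r. X' i x * R i l)"
      using QR' l unfolding is_QR_x_def by blast
    then show "(\<Sum>i=1..r. X' i x * R i l) * (if l \<le> m then Scons l k else 0)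
        = (if l \<le> m then Xcons l x * Scons l k else 0)"
      by (auto split: if_splits)
  qed
  also have "\<dots> = (\<Sum>l=1..m. Xcons l x * Scons l k)"
    using m_le_r by (intro sum.mono_neutral_cong_right) auto
  also have "\<dots> = (\<Sum>l=1..nx. Xt l x * St l k)"
    using QR k unfolding is_QR_x_def by simp
  finally show "(LINT v:\<Omega>v|lborel. lowrank f0v r r X' S' V' x v * U k v) = (\<Sum>l=1..nx. Xt l x * St l k)" .
qed

section \<open>Momentum balance\<close>

lemma div_stress:
  "div_tensor (stress \<Omega>v f) x $ c = (\<Sum>i=1..r. \<Sum>j=1..r. S i j * (\<Sum>t\<in>UNIV.
      partial t (X i) x * ip_v \<Omega>v f0v (\<lambda>v. v $ c) (\<lambda>v. v $ t * V j v)))"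
proof -
  have sint: "set_integrable lborel \<Omega>v (\<lambda>v. f0v v * (V j v * (v $ s * v $ t)))" if "j \<in> {1..r}" for j s t
    using mult_integrable[OF _ velocity_L2 velocity_V_L2[OF that], of s t] by (simp add: mult_ac)
  have sm: "stress \<Omega>v f y $ s $ t = (\<Sum>i=1..r. \<Sum>j=1..r. X i y * S i j * ip_v \<Omega>v f0v (V j) (\<lambda>v. v $ s * v $ t))"
    for y s t
  proof -
    have 0: "set_integrable lborel \<Omega>v (\<lambda>v. (f y v *\<^sub>R (\<chi> i j. v $ i * v $ j)) $ s $ t)" for s t
      using lowrank_moment(1)[OF sint] by simp
    have "stress \<Omega>v f y $ s $ t = (LINT v:\<Omega>v|lborel. (f y v *\<^sub>R (\<chi> i j. v $ i * v $ j)) $ s $ t)"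
      unfolding stress_def set_integral_vec_nth(2)[OF set_integral_vec_nth(1)[OF 0]]
      by (rule set_integral_vec_nth(2)[OF 0])
    then show ?thesis
      using lowrank_moment(2)[OF sint] by simp
  qed
  have "partial t (\<lambda>y. stress \<Omega>v f y $ c $ t) x
      = (\<Sum>i=1..r. \<Sum>j=1..r. S i j * (partial t (X i) x * ip_v \<Omega>v f0v (\<lambda>v. v $ c) (\<lambda>v. v $ t * V j v)))" for t
  proof -
    have "(\<lambda>y. stress \<Omega>v f y $ c $ t) = (\<lambda>y. \<Sum>i=1..r. (\<Sum>j=1..r. S i j * ip_v \<Omega>v f0v (V j) (\<lambda>v. v $ c * v $ t)) * X i y)"
      by (simp add: sm sum_distrib_left sum_distrib_right mult_ac)
    then have "partial t (\<lambda>y. stress \<Omega>v f y $ c $ t) x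
        = (\<Sum>i=1..r. (\<Sum>j=1..r. S i j * ip_v \<Omega>v f0v (V j) (\<lambda>v. v $ c * v $ t)) * partial t (X i) x)"
      by (simp only:) (rule partial_weighted_sum[OF C1_on_UNIV_differentiable[OF X_C1]])
    moreover have "ip_v \<Omega>v f0v (V j) (\<lambda>v. v $ c * v $ t) = ip_v \<Omega>v f0v (\<lambda>v. v $ c) (\<lambda>v. v $ t * V j v)" for j
      by (simp add: ip_v_def mult_ac)
    ultimately show ?thesis
      by (simp add: sum_distrib_left sum_distrib_right mult_ac)
  qed
  then have "div_tensor (stress \<Omega>v f) x $ c = (\<Sum>t\<in>UNIV. \<Sum>i=1..r. \<Sum>j=1..r.
      S i j * (partial t (X i) x * ip_v \<Omega>v f0v (\<lambda>v. v $ c) (\<lambda>v. v $ t * V j v)))"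
    by (simp add: div_tensor_def)
  also have "\<dots> = (\<Sum>i=1..r. \<Sum>j=1..r. \<Sum>t\<in>UNIV.
      S i j * (partial t (X i) x * ip_v \<Omega>v f0v (\<lambda>v. v $ c) (\<lambda>v. v $ t * V j v)))"
    by (subst sum.swap) (intro sum.cong refl sum.swap)
  finally show "div_tensor (stress \<Omega>v f) x $ c = (\<Sum>i=1..r. \<Sum>j=1..r. S i j * (\<Sum>t\<in>UNIV.
      partial t (X i) x * ip_v \<Omega>v f0v (\<lambda>v. v $ c) (\<lambda>v. v $ t * V j v)))"
    by (simp only: sum_distrib_left)
qed

lemma div_stress_total_zero:
  assumes ab: "\<And>i. a $ i < b $ i"
  shows "set_integrable lborel (cbox a b) (\<lambda>x. div_tensor (stress \<Omega>v f) x $ c)"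
    and "(LINT x:cbox a b|lborel. div_tensor (stress \<Omega>v f) x $ c) = 0"
proof -
  let ?c = "\<lambda>t j. ip_v \<Omega>v f0v (\<lambda>v. v $ c) (\<lambda>v. v $ t * V j v)"
  have int3: "set_integrable lborel (cbox a b) (\<lambda>x. partial t (X i) x * ?c t j)" if "i \<in> {1..r}" for i j t
    by (intro set_integrable_mult_left set_integrable_continuous_cbox
        C1_on_UNIV_continuous_partial X_C1 that)
  have int2: "set_integrable lborel (cbox a b) (\<lambda>x. S i j * (\<Sum>t\<in>UNIV. partial t (X i) x * ?c t j))"
    if "i \<in> {1..r}" for i j
    by (intro set_integrable_mult_right set_integral_finite_sum(1) int3 that)
  have int1: "set_integrable lborel (cbox a b)
      (\<lambda>x. \<Sum>j=1..r. S i j * (\<Sum>t\<in>UNIV. partial t (X i) x * ?c t j))" if "i \<in> {1..r}" for i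
    by (rule set_integral_finite_sum(1)[OF int2[OF that]])
  show "set_integrable lborel (cbox a b) (\<lambda>x. div_tensor (stress \<Omega>v f) x $ c)"
    unfolding div_stress by (rule set_integral_finite_sum(1)[OF int1])
  have "(LINT x:cbox a b|lborel. partial t (X i) x) = 0" if "i \<in> {1..r}" for i t
    using X_L2[OF that] by (intro integral_partial_periodic ab X_C1 that) (simp add: L2_x_def)
  then have "(LINT x:cbox a b|lborel. S i j * (\<Sum>t\<in>UNIV. partial t (X i) x * ?c t j)) = 0"
    if "i \<in> {1..r}" for i j
    using that by (simp add: set_integral_finite_sum(2)[OF int3[OF that]] del: One_nat_def)
  then have "(LINT x:cbox a b|lborel. \<Sum>j=1..r. S i j * (\<Sum>t\<in>UNIV. partial t (X i) x * ?c t j)) = 0"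
    if "i \<in> {1..r}" for i
    unfolding set_integral_finite_sum(2)[OF int2[OF that]] using that by (intro sum.neutral) blast
  then show "(LINT x:cbox a b|lborel. div_tensor (stress \<Omega>v f) x $ c) = 0"
    unfolding div_stress
    by (subst set_integral_finite_sum(2)[OF int1]) (assumption, intro sum.neutral ballI)
qed

text \<open>
  The first velocity moment of the Vlasov equation.  The transport term yields minus the divergence
  of the stress, and integration by parts against \<open>v $ c\<close>, a multiple of a fixed function, turns
  the acceleration term into \<open>- \<rho> E\<close>.
\<close>

lemma velocity_moment_RHS:
  assumes e: "bij_betw e {1..CARD('d)} UNIV" and m: "CARD('d) + 1 \<le> m"
  shows "pair_v \<Omega>v (\<lambda>v. v $ c) (RHS a b \<Omega>v f x)
    = - div_tensor (stress \<Omega>v f) x $ c - rho \<Omega>v f x * E x $ c"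
proof -
  obtain k n where k: "k \<in> {1..m}" and n: "n \<noteq> 0" and Uk: "\<And>v. U k v = v $ c / n"
    and cU: "\<And>v. v $ c = n * U k v"
    using velocity_fixed[OF e m, of c] by blast
  have parts: "(LINT v:\<Omega>v|lborel. v $ c * partial t (\<lambda>w. f0v w * V j w) v)
      = - (if t = c then ip_v \<Omega>v f0v (V j) (\<lambda>_. 1) else 0)" if j: "j \<in> {1..r}" for t j
  proof -
    have pU: "partial t (U k) v = (if t = c then 1 / n else 0)" for v
    proof -
      have "((\<lambda>v. v $ c / n) has_derivative (\<lambda>v. v $ c / n)) (at v)"
        by (intro bounded_linear_imp_has_derivative bounded_linear_divide[THEN bounded_linear_compose]
            bounded_linear_vec_nth)
      moreover have "U k = (\<lambda>v. v $ c / n)"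
        using Uk by auto
      ultimately show ?thesis
        by (auto simp: partial_eqI axis_def)
    qed
    have "(LINT v:\<Omega>v|lborel. v $ c * partial t (\<lambda>w. f0v w * V j w) v)
        = n * (LINT v:\<Omega>v|lborel. U k v * partial t (\<lambda>w. f0v w * V j w) v)"
      by (simp add: cU mult.assoc)
    also have "\<dots> = - (n * (LINT v:\<Omega>v|lborel. (if t = c then 1 / n else 0) * (f0v v * V j v)))"
      by (simp add: integration_by_parts[OF k j] pU)
    also have "\<dots> = - (if t = c then ip_v \<Omega>v f0v (V j) (\<lambda>_. 1) else 0)"
      using n by (simp add: ip_v_def)
    finally show ?thesis .
  qed
  have rho: "rho \<Omega>v f x = (\<Sum>i=1..r. \<Sum>j=1..r. X i x * S i j * ip_v \<Omega>v f0v (V j) (\<lambda>_. 1))"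
    using lowrank_moment(2)[of r \<Omega>v f0v V "\<lambda>_. 1" r X S x] mult_integrable[OF _ V_L2 one_L2]
    by (simp add: rho_def)
  have "pair_v \<Omega>v (\<lambda>v. v $ c) (RHS a b \<Omega>v f x) = (\<Sum>i=1..r. \<Sum>j=1..r. S i j * (\<Sum>t\<in>UNIV.
      (if t = c then - (E x $ t * X i x * ip_v \<Omega>v f0v (V j) (\<lambda>_. 1)) else 0)
      - partial t (X i) x * ip_v \<Omega>v f0v (\<lambda>v. v $ c) (\<lambda>v. v $ t * V j v)))"
    unfolding RHS_moment[OF velocity_L2]
    by (intro sum.cong refl arg_cong2[where f = "(*)"]) (simp add: parts)
  also have "\<dots> = - div_tensor (stress \<Omega>v f) x $ c - rho \<Omega>v f x * E x $ c"
    unfolding div_stress rho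
    by (simp add: sum_subtractf sum_negf sum_distrib_left sum_distrib_right right_diff_distrib mult_ac)
  finally show ?thesis .
qed

end

theorem theorem2:
  fixes a b :: "real^'d" and \<Omega>v :: "(real^'d) set" and f0v :: "real^'d \<Rightarrow> real"
    and e :: "nat \<Rightarrow> 'd" and \<tau> :: real and m r :: nat
    and X V X' V' :: "nat \<Rightarrow> real^'d \<Rightarrow> real" and S S' :: "nat \<Rightarrow> nat \<Rightarrow> real"
    and f f' :: "real^'d \<Rightarrow> real^'d \<Rightarrow> real"
  assumes "\<And>i. a $ i < b $ i" and "open \<Omega>v"
    and "bij_betw e {1..CARD('d)} UNIV"
    and "admissible_weight \<Omega>v f0v e m"
    and "CARD('d) + 1 \<le> m" and "m \<le> CARD('d) + 2" and "m \<le> r"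
    and "\<tau> > 0"
    and "lowrank_factors a b \<Omega>v f0v e m r X V"
    and "f = lowrank f0v r r X S V"
    and "(LINT z:cbox a b \<times> \<Omega>v|lborel. f (fst z) (snd z)) = measure lborel (cbox a b)"
    and "\<exists>\<phi>. poisson_potential a b \<Omega>v f \<phi>"
    and "integrator_step a b \<Omega>v f0v e \<tau> m r X S V X' S' V'"
    and "f' = lowrank f0v r r X' S' V'"
  shows "(\<forall>x. (1 / \<tau>) *\<^sub>R (momentum \<Omega>v f' x - momentum \<Omega>v f x)
              + div_tensor (stress \<Omega>v f) x + rho \<Omega>v f x *\<^sub>R E_field a b \<Omega>v f x = 0)
       \<and> (LINT z:cbox a b \<times> \<Omega>v|lborel. f' (fst z) (snd z) *\<^sub>R snd z)
         = (LINT z:cbox a b \<times> \<Omega>v|lborel. f (fst z) (snd z) *\<^sub>R snd z)"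
proof -
  interpret st: lowrank_state a b \<Omega>v f0v e m r X V S
    using assms(2,4,7,9) assms(12)[unfolded assms(10)] by (rule lowrank_state.intro)
  let ?f = "lowrank f0v r r X S V" and ?f' = "lowrank f0v r r X' S' V'"
  let ?E = "E_field a b \<Omega>v ?f"
  obtain nx Xt nv Vt where
    aug: "augmented_bases a b \<Omega>v f0v e \<tau> m r X S V nx Xt nv Vt" and
    trunc: "truncation a b \<Omega>v f0v e m r nx Xt (S_new a b \<Omega>v f0v \<tau> r X S V nx Xt nv Vt) nv Vt X' S' V'"
    using assms(13) unfolding integrator_step_def by blast
  have Vt: "orthonormal_v \<Omega>v f0v nv Vt" "m \<le> nv"
    "\<And>k v. k \<in> {1..m} \<Longrightarrow> v \<in> \<Omega>v \<Longrightarrow> Vt k v = fixed_fun \<Omega>v f0v e k v"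
    using aug by (auto simp: augmented_bases_def)
  have X'_L2: "L2_x a b (X' i)" if "i \<in> {1..r}" for i
    using trunc that unfolding truncation_def Let_def is_QR_x_def orthonormal_x_def by blast
  have int: "set_integrable lborel \<Omega>v (\<lambda>v. f0v v * (V j v * v $ c))"
    "set_integrable lborel \<Omega>v (\<lambda>v. f0v v * (V' j v * v $ c))" if j: "j \<in> {1..r}" for j c
  proof -
    show "set_integrable lborel \<Omega>v (\<lambda>v. f0v v * (V j v * v $ c))"
      by (rule st.mult_integrable[OF _ st.V_L2[OF j] st.velocity_L2])
    obtain k n where k: "k \<in> {1..m}" and cU: "\<And>v. v $ c = n * fixed_fun \<Omega>v f0v e k v"
      by (rule st.velocity_fixed[OF assms(3,5), of c]) blast
    have "set_integrable lborel \<Omega>v (\<lambda>v. n * (f0v v * (V' j v * fixed_fun \<Omega>v f0v e k v)))"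
      by (intro set_integrable_mult_right st.truncation_moment(1)[OF Vt trunc k j])
    then show "set_integrable lborel \<Omega>v (\<lambda>v. f0v v * (V' j v * v $ c))"
      by (simp add: cU mult_ac)
  qed
  have mom: "momentum \<Omega>v ?f x $ c = (LINT v:\<Omega>v|lborel. ?f x v * v $ c)"
    "momentum \<Omega>v ?f' x $ c = (LINT v:\<Omega>v|lborel. ?f' x v * v $ c)" for x c
  proof -
    have "set_integrable lborel \<Omega>v (\<lambda>v. ?f x v * v $ c)" for c
      by (rule lowrank_moment(1)[where h = "\<lambda>v. v $ c"]) (rule int(1))
    then show "momentum \<Omega>v ?f x $ c = (LINT v:\<Omega>v|lborel. ?f x v * v $ c)"
      by (rule momentum_nth)
    have "set_integrable lborel \<Omega>v (\<lambda>v. ?f' x v * v $ c)" for c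
      by (rule lowrank_moment(1)[where h = "\<lambda>v. v $ c"]) (rule int(2))
    then show "momentum \<Omega>v ?f' x $ c = (LINT v:\<Omega>v|lborel. ?f' x v * v $ c)"
      by (rule momentum_nth)
  qed
  have step: "momentum \<Omega>v ?f' x $ c - momentum \<Omega>v ?f x $ c
      = \<tau> * (- div_tensor (stress \<Omega>v ?f) x $ c - rho \<Omega>v ?f x * ?E x $ c)" for x c
  proof -
    obtain k n where k: "k \<in> {1..m}" and cU: "\<And>v. v $ c = n * fixed_fun \<Omega>v f0v e k v"
      by (rule st.velocity_fixed[OF assms(3,5), of c]) blast
    have k_r: "k \<in> {1..r}"
      using k assms(7) by auto
    have "momentum \<Omega>v ?f' x $ c = n * (LINT v:\<Omega>v|lborel. ?f' x v * fixed_fun \<Omega>v f0v e k v)"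
      unfolding mom by (simp add: cU mult.left_commute)
    also have "\<dots> = n * K_new a b \<Omega>v f0v \<tau> r X S V k x"
      by (simp only: st.truncation_moment(2)[OF Vt trunc k] st.augmented_column[OF aug k])
    also have "\<dots> = n * (\<Sum>i=1..r. X i x * S i k) + \<tau> * (n * pair_v \<Omega>v (V k) (RHS a b \<Omega>v ?f x))"
      by (simp add: K_new_def algebra_simps)
    also have "n * pair_v \<Omega>v (V k) (RHS a b \<Omega>v ?f x) = pair_v \<Omega>v (\<lambda>v. v $ c) (RHS a b \<Omega>v ?f x)"
      unfolding pair_v_def set_integral_mult_right[symmetric]
      by (rule set_integral_eqI) (simp add: cU st.V_fixed[OF k])
    also have "n * (\<Sum>i=1..r. X i x * S i k) = momentum \<Omega>v ?f x $ c"
    proof -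
      have moment: "momentum \<Omega>v ?f x $ c
          = (\<Sum>i=1..r. \<Sum>j=1..r. X i x * S i j * ip_v \<Omega>v f0v (V j) (\<lambda>v. v $ c))"
        unfolding mom by (rule lowrank_moment(2)) (rule int(1))
      have "ip_v \<Omega>v f0v (V j) (\<lambda>v. v $ c) = (if j = k then n else 0)" if j: "j \<in> {1..r}" for j
      proof -
        have "ip_v \<Omega>v f0v (V j) (\<lambda>v. v $ c) = n * ip_v \<Omega>v f0v (V j) (V k)"
          unfolding ip_v_def set_integral_mult_right[symmetric]
          by (rule set_integral_eqI) (simp add: cU st.V_fixed[OF k])
        then show ?thesis
          using st.V_orthonormal j k_r by (simp add: orthonormal_v_def)
      qed
      then have "momentum \<Omega>v ?f x $ c = (\<Sum>i=1..r. \<Sum>j=1..r. if j = k then X i x * S i j * n else 0)"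
        unfolding moment by (intro sum.cong refl) simp
      then show ?thesis
        using k_r by (simp add: sum_distrib_left mult_ac)
    qed
    finally show ?thesis
      by (simp add: st.velocity_moment_RHS[OF assms(3,5)])
  qed
  have cont: "(1 / \<tau>) *\<^sub>R (momentum \<Omega>v ?f' x - momentum \<Omega>v ?f x)
      + div_tensor (stress \<Omega>v ?f) x + rho \<Omega>v ?f x *\<^sub>R ?E x = 0" for x
    using assms(8) by (simp add: vec_eq_iff step)
  have tot: "(LINT z:cbox a b \<times> \<Omega>v|lborel. ?f' (fst z) (snd z) *\<^sub>R snd z) $ c
      = (LINT z:cbox a b \<times> \<Omega>v|lborel. ?f (fst z) (snd z) *\<^sub>R snd z) $ c" for c
  proof -
    have total: "(LINT z:cbox a b \<times> \<Omega>v|lborel. lowrank f0v r r Y T W (fst z) (snd z) *\<^sub>R snd z) $ c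
          = (LINT x:cbox a b|lborel. momentum \<Omega>v (lowrank f0v r r Y T W) x $ c)"
        "set_integrable lborel (cbox a b) (\<lambda>x. momentum \<Omega>v (lowrank f0v r r Y T W) x $ c)"
      if Y: "\<And>i. i \<in> {1..r} \<Longrightarrow> L2_x a b (Y i)"
        and W: "\<And>j c. j \<in> {1..r} \<Longrightarrow> set_integrable lborel \<Omega>v (\<lambda>v. f0v v * (W j v * v $ c))"
        and mom: "\<And>x. momentum \<Omega>v (lowrank f0v r r Y T W) x $ c
          = (LINT v:\<Omega>v|lborel. lowrank f0v r r Y T W x v * v $ c)" for Y T W
    proof -
      have prod: "set_integrable lborel (cbox a b \<times> \<Omega>v)
          (\<lambda>z. lowrank f0v r r Y T W (fst z) (snd z) * snd z $ c)" for c
        by (rule lowrank_moment_integrable_prod[where h = "\<lambda>v. v $ c", OF W L2_x_integrable[OF Y]])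
      show "(LINT z:cbox a b \<times> \<Omega>v|lborel. lowrank f0v r r Y T W (fst z) (snd z) *\<^sub>R snd z) $ c
          = (LINT x:cbox a b|lborel. momentum \<Omega>v (lowrank f0v r r Y T W) x $ c)"
        using prod set_integral_Fubini[of "cbox a b" \<Omega>v "\<lambda>x v. lowrank f0v r r Y T W x v * v $ c", OF prod]
        by (subst set_integral_vec_nth(2)) (simp_all add: mom)
      have moment: "momentum \<Omega>v (lowrank f0v r r Y T W) x $ c
          = (\<Sum>i=1..r. \<Sum>j=1..r. Y i x * T i j * ip_v \<Omega>v f0v (W j) (\<lambda>v. v $ c))" for x
        unfolding mom by (rule lowrank_moment(2)) (rule W)
      show "set_integrable lborel (cbox a b) (\<lambda>x. momentum \<Omega>v (lowrank f0v r r Y T W) x $ c)"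
        unfolding moment
        by (intro set_integral_finite_sum(1) set_integrable_mult_left L2_x_integrable Y)
    qed
    have int': "set_integrable lborel (cbox a b) (\<lambda>x. momentum \<Omega>v ?f' x $ c)"
      by (rule total(2)[OF _ _ mom(2)]) (auto intro: X'_L2 int(2))
    have int0: "set_integrable lborel (cbox a b) (\<lambda>x. momentum \<Omega>v ?f x $ c)"
      by (rule total(2)[OF _ _ mom(1)]) (auto intro: st.X_L2 int(1))
    have tot': "(LINT z:cbox a b \<times> \<Omega>v|lborel. ?f' (fst z) (snd z) *\<^sub>R snd z) $ c
        = (LINT x:cbox a b|lborel. momentum \<Omega>v ?f' x $ c)"
      by (rule total(1)[OF _ _ mom(2)]) (auto intro: X'_L2 int(2))
    have tot0: "(LINT z:cbox a b \<times> \<Omega>v|lborel. ?f (fst z) (snd z) *\<^sub>R snd z) $ c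
        = (LINT x:cbox a b|lborel. momentum \<Omega>v ?f x $ c)"
      by (rule total(1)[OF _ _ mom(1)]) (auto intro: st.X_L2 int(1))
    note div = st.div_stress_total_zero[OF assms(1), of c]
      and force = total_force_zero[OF assms(1) st.potential, of c]
    have "(LINT x:cbox a b|lborel. momentum \<Omega>v ?f' x $ c) - (LINT x:cbox a b|lborel. momentum \<Omega>v ?f x $ c)
        = (LINT x:cbox a b|lborel. momentum \<Omega>v ?f' x $ c - momentum \<Omega>v ?f x $ c)"
      by (rule set_integral_diff(2)[OF int' int0, symmetric])
    also have "\<dots> = (LINT x:cbox a b|lborel.
        - \<tau> * (div_tensor (stress \<Omega>v ?f) x $ c + rho \<Omega>v ?f x * ?E x $ c))"
      by (rule set_integral_eqI) (simp add: step algebra_simps)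
    also have "\<dots> = 0"
      using set_integral_add(2)[OF div(1) force(1)] div(2) force(2)
      by (simp only: set_integral_mult_right add_0 mult_zero_right)
    finally show ?thesis
      by (simp add: tot' tot0)
  qed
  show ?thesis
    using cont tot by (simp add: assms(10,14) vec_eq_iff)
qed

end
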